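(* Let $X$ be a Banach space and let $Y_1, M, N, Y_2$ be closed linear subspaces of $X$ such that $M+N$ is closed and $Y_1\subset M\cap N\subset M+N\subset Y_2$. (a) Assume that $\dim Y_2/(M+N)$ is finite. Then there is $\varepsilon>0$ such that for every triple $(M',N',Y_2')$ of closed linear subspaces of $X$ with $M'+N'\subset Y_2'$ and $\delta(M,M')<\varepsilon$, $\delta(N,N')<\varepsilon$, $\delta(Y_2',Y_2)<\varepsilon$, the space $M'+N'$ is closed and $$\dim Y_2'/(M'+N')\le \dim Y_2/(M+N).$$ (b) Assume that $\dim (M\cap N)/Y_1$ is finite. Then there is $\varepsilon>0$ such that for every triple $(Y_1',M',N')$ of closed linear subspaces of $X$ with $Y_1'\subset M'\cap N'$ and $\delta(Y_1,Y_1')<\varepsilon$, $\delta(M',M)<\varepsilon$, $\delta(N',N)<\varepsilon$, the space $M'+N'$ is closed and $$\dim (M'\cap N')/Y_1'\le \dim (M\cap N)/Y_1.$$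
   Context: For linear subspaces $A,B$ of a Banach space $X$, let $\operatorname{S}_A$ be the unit sphere of $A$ and define the (one-sided) gap $\delta(A,B):=\sup_{u\in \operatorname{S}_A}\operatorname{dist}(u,B)$ if $A\neq\{0\}$ and $\delta(\{0\},B):=0$. *)

theory Defs
  imports "HOL-Analysis.Analysis" "HOL-Library.Extended_Nat"
begin

definition ssum :: "'a::real_vector set \<Rightarrow> 'a set \<Rightarrow> 'a set" where
  "ssum A B = {x + y | x y. x \<in> A \<and> y \<in> B}"

definition closed_subspace :: "'a::real_normed_vector set \<Rightarrow> bool" where
  "closed_subspace S \<longleftrightarrow> subspace S \<and> closed S"

definition gap :: "'a::real_normed_vector set \<Rightarrow> 'a set \<Rightarrow> real" where
  "gap A B = (if A = {0} then 0 else (SUP u\<in>{u\<in>A. norm u = 1}. infdist u B))"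

text \<open>Dimension of the quotient space Y/Z (with values in enat): the supremum of the
  sizes of finite families in Y whose cosets modulo Z are linearly independent in Y/Z.\<close>
definition indep_mod :: "'a::real_vector set \<Rightarrow> 'a set \<Rightarrow> 'a set \<Rightarrow> bool" where
  "indep_mod F Y Z \<longleftrightarrow> finite F \<and> F \<subseteq> Y \<and>
     (\<forall>c. (\<Sum>f\<in>F. c f *\<^sub>R f) \<in> Z \<longrightarrow> (\<forall>f\<in>F. c f = 0))"

definition qdim :: "'a::real_vector set \<Rightarrow> 'a set \<Rightarrow> enat" where
  "qdim Y Z = (SUP F\<in>{F. indep_mod F Y Z}. enat (card F))"

end

theory Submission
  imports Defs
begin

text \<open>
  By the open mapping theorem, a sum of closed subspaces \<open>M + N\<close> is closed iff each of its elements
  \<open>x\<close> splits as \<open>x = m + k\<close> with \<open>\<parallel>m\<parallel> \<le> C \<parallel>x\<parallel>\<close>, and such estimates survive small gap perturbations up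
  to a small relative error. If \<open>F\<close> represents a basis of the finite-dimensional quotient, every
  unit vector of \<open>Y2'\<close> is \<open>\<theta>\<close>-close to \<open>M' + N' + span F\<close> in (a), and every unit vector of
  \<open>M'\<close> that is nearly in \<open>N'\<close> is \<open>\<theta>\<close>-close to \<open>Y1' + span F\<close> in (b). When \<open>\<theta>\<close> is small in terms of
  \<open>card F\<close> only, more than \<open>card F\<close> vectors that are well separated modulo a subspace \<open>Z\<close> cannot all be
  \<open>\<theta>\<close>-close to \<open>Z + span F\<close>; applied to a Riesz sequence this bounds the dimensions.

  Closedness in (a): by compactness, finitely many vectors of \<open>Y2'\<close> can replace \<open>F\<close>, so \<open>M' + N'\<close> has
  finite codimension in \<open>Y2'\<close>, and sums of finite codimension are closed. Closedness in (b):
  otherwise, splitting off closed hyperplanes of \<open>M'\<close> one at a time (Hahn--Banach) leaves the sum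
  non-closed, which yields arbitrarily many well separated vectors of \<open>M'\<close> that are nearly in \<open>N'\<close>.
\<close>

subsection \<open>Algebraic sums\<close>

lemma ssumI: "x \<in> A \<Longrightarrow> y \<in> B \<Longrightarrow> x + y \<in> ssum A B"
  by (auto simp: ssum_def)

lemma ssumE:
  assumes "z \<in> ssum A B"
  obtains x y where "x \<in> A" "y \<in> B" "z = x + y"
  using assms by (auto simp: ssum_def)

lemma subspace_ssum: "subspace A \<Longrightarrow> subspace B \<Longrightarrow> subspace (ssum A B)"
  unfolding ssum_def by (rule subspace_sums)

lemma ssum_commute: "ssum A B = ssum B A"
  by (auto simp: ssum_def) (metis add.commute)+

lemma ssum_assoc: "ssum (ssum A B) C = ssum A (ssum B C)"
  by (auto simp: ssum_def) (metis add.assoc)+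

lemma ssum_superset1: "subspace B \<Longrightarrow> A \<subseteq> ssum A B"
  using ssumI[of _ A 0 B] subspace_0 by fastforce

lemma ssum_superset2: "subspace A \<Longrightarrow> B \<subseteq> ssum A B"
  using ssumI[of 0 A _ B] subspace_0 by fastforce

lemma ssum_mono: "A \<subseteq> A' \<Longrightarrow> B \<subseteq> B' \<Longrightarrow> ssum A B \<subseteq> ssum A' B'"
  by (auto simp: ssum_def)

lemma ssum_subset: "subspace C \<Longrightarrow> A \<subseteq> C \<Longrightarrow> B \<subseteq> C \<Longrightarrow> ssum A B \<subseteq> C"
  by (auto simp: ssum_def intro: subspace_add)

lemma ssum_span_insert: "ssum Z (span (insert v F)) = ssum (ssum Z (span F)) (span {v})"
proof -
  have "span (insert v F) = ssum (span F) (span {v})"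
    using span_Un[of F "{v}"] by (simp add: ssum_def)
  then show ?thesis by (simp add: ssum_assoc)
qed

lemma ssum_span_singletonE:
  assumes "x \<in> ssum Z (span {v})"
  obtains z a where "z \<in> Z" "x = z + a *\<^sub>R v"
  using assms by (auto simp: ssum_def span_singleton)

subsection \<open>Sums of closed subspaces\<close>

lemma sums_norm_geometric:
  fixes f :: "nat \<Rightarrow> 'a::banach"
  assumes "\<And>i. norm (f i) \<le> B * (1/2)^i"
  shows "summable f" and "norm (suminf f) \<le> 2 * B"
proof -
  have s: "(\<lambda>i. B * (1/2::real)^i) sums (B * 2)"
    using geometric_sums[of "1/2::real"] by (intro sums_mult) simp
  have n: "summable (\<lambda>i. norm (f i))"
    by (rule summable_comparison_test'[OF sums_summable[OF s], of 0]) (simp add: assms)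
  then show "summable f" by (rule summable_norm_cancel)
  have "norm (suminf f) \<le> (\<Sum>i. norm (f i))" using n by (rule summable_norm)
  also have "\<dots> \<le> (\<Sum>i. B * (1/2)^i)"
    using n s by (intro suminf_le assms) (auto intro: sums_summable)
  also have "\<dots> = 2 * B" using s by (simp add: sums_iff)
  finally show "norm (suminf f) \<le> 2 * B" .
qed

lemma suminf_in_closed_subspace:
  fixes f :: "nat \<Rightarrow> 'a::real_normed_vector"
  assumes "closed_subspace M" "summable f" "\<And>i. f i \<in> M"
  shows "suminf f \<in> M"
proof (rule closed_sequentially)
  show "closed M" using assms by (simp add: closed_subspace_def)
  show "(\<lambda>n. \<Sum>i<n. f i) \<longlonglongrightarrow> suminf f" using assms(2) by (rule summable_LIMSEQ)
  show "(\<Sum>i<n. f i) \<in> M" for n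
    using assms by (auto simp: closed_subspace_def intro: subspace_sum)
qed

text \<open>Successive approximation, as in the proof of the open mapping theorem.\<close>

lemma approximate_decomposition_imp_exact:
  fixes M N S :: "'a::banach set"
  assumes M: "closed_subspace M" and N: "closed_subspace N" and "y \<in> S" and "C \<ge> 0"
    and approx: "\<And>y. y \<in> S \<Longrightarrow> \<exists>m\<in>M. \<exists>k\<in>N. y - (m + k) \<in> S \<and> norm m \<le> C * norm y
       \<and> norm k \<le> C * norm y \<and> norm (y - (m + k)) \<le> norm y / 2"
  shows "\<exists>m\<in>M. \<exists>k\<in>N. y = m + k \<and> norm m \<le> 2 * C * norm y"
proof -
  obtain p q where pq: "\<And>y. y \<in> S \<Longrightarrow> p y \<in> M \<and> q y \<in> N \<and> y - (p y + q y) \<in> S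
      \<and> norm (p y) \<le> C * norm y \<and> norm (q y) \<le> C * norm y
      \<and> norm (y - (p y + q y)) \<le> norm y / 2"
    using approx by metis
  \<comment> \<open>\<open>r i\<close> is the residual after \<open>i\<close> corrections. It halves
    each time, so the corrections telescope to \<open>y\<close>, and the geometric series accounts
    for the factor 2.\<close>
  define r where "r = (\<lambda>i. ((\<lambda>y. y - (p y + q y)) ^^ i) y)"
  have r0: "r 0 = y" and rS: "r (Suc i) = r i - (p (r i) + q (r i))" for i
    by (simp_all add: r_def)
  have rin: "r i \<in> S" for i by (induction i) (use pq \<open>y \<in> S\<close> in \<open>auto simp: r0 rS\<close>)
  have rn: "norm (r i) \<le> norm y * (1/2)^i" for i
  proof (induction i)
    case (Suc i)
    have "norm (r (Suc i)) \<le> norm (r i) / 2" using pq[OF rin] by (simp add: rS)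
    with Suc show ?case by simp
  qed (simp add: r0)
  have rC: "C * norm (r i) \<le> C * norm y * (1/2)^i" for i
    using mult_left_mono[OF rn \<open>C \<ge> 0\<close>] by (simp add: mult.assoc)
  have pn: "norm (p (r i)) \<le> C * norm y * (1/2)^i" and qn: "norm (q (r i)) \<le> C * norm y * (1/2)^i" for i
    using pq[OF rin, of i] rC[of i] by linarith+
  note P = sums_norm_geometric[OF pn] and Q = sums_norm_geometric[OF qn]
  have "(\<Sum>i<n. p (r i) + q (r i)) = y - r n" for n
    by (induction n) (auto simp: r0 rS)
  moreover have "r \<longlonglongrightarrow> 0"
  proof (rule Lim_null_comparison)
    show "(\<lambda>i. norm y * (1/2::real)^i) \<longlonglongrightarrow> 0"
      by (intro tendsto_mult_right_zero LIMSEQ_realpow_zero) auto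
  qed (use rn in auto)
  then have "(\<lambda>n. y - r n) \<longlonglongrightarrow> y" by (auto intro: tendsto_eq_intros)
  ultimately have "(\<lambda>i. p (r i) + q (r i)) sums y" by (simp add: sums_def)
  moreover have "(\<lambda>i. p (r i) + q (r i)) sums (suminf (\<lambda>i. p (r i)) + suminf (\<lambda>i. q (r i)))"
    using P(1) Q(1) by (intro sums_add summable_sums)
  ultimately have "y = suminf (\<lambda>i. p (r i)) + suminf (\<lambda>i. q (r i))" by (rule sums_unique2)
  moreover have "suminf (\<lambda>i. p (r i)) \<in> M" "suminf (\<lambda>i. q (r i)) \<in> N"
    using pq[OF rin] by (auto intro!: suminf_in_closed_subspace M N P(1) Q(1))
  ultimately show ?thesis using P(2) by (auto simp: mult.assoc)
qed

text \<open>Quantitative openness of the addition map from pairs in \<open>M\<close>,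
  \<open>N\<close> onto their sum. A bound on \<open>m\<close> also bounds \<open>k = x - m\<close>,
  with constant \<open>1 + C\<close>.\<close>

definition bounded_decomp :: "'a::real_normed_vector set \<Rightarrow> 'a set \<Rightarrow> real \<Rightarrow> bool" where
  "bounded_decomp M N C \<longleftrightarrow>
     (\<forall>x\<in>ssum M N. \<exists>m\<in>M. \<exists>k\<in>N. x = m + k \<and> norm m \<le> C * norm x)"

text \<open>A point of the closure lies within half its norm of a point of the sum, whose controlled
  splitting serves as one correction step. The residual stays in the closure, so successive
  approximation splits every closure point exactly.\<close>

lemma bounded_decomp_imp_closed:
  fixes M N :: "'a::banach set"
  assumes M: "closed_subspace M" and N: "closed_subspace N" and bd: "bounded_decomp M N C"
  shows "closed (ssum M N)"
proof -
  \<comment> \<open>The sign of \<open>C\<close> is not assumed, while successive approximation asks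
    for a nonnegative constant.\<close>
  define D where "D = max C 0"
  have bd': "\<exists>m\<in>M. \<exists>k\<in>N. x = m + k \<and> norm m \<le> D * norm x" if "x \<in> ssum M N" for x
  proof -
    have "C * norm x \<le> D * norm x" by (rule mult_right_mono) (auto simp: D_def)
    with bd that show ?thesis unfolding bounded_decomp_def by (meson order_trans)
  qed
  have sub: "subspace (ssum M N)"
    using M N by (simp add: closed_subspace_def subspace_ssum)
  have "y \<in> ssum M N" if y: "y \<in> closure (ssum M N)" for y
  proof -
    have "\<exists>m\<in>M. \<exists>k\<in>N. y = m + k \<and> norm m \<le> 2 * (2 * D + 2) * norm y"
    proof (rule approximate_decomposition_imp_exact[OF M N y])
      show "0 \<le> 2 * D + 2" by (simp add: D_def)
      fix y assume y: "y \<in> closure (ssum M N)"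
      obtain x where x: "x \<in> ssum M N" "norm (y - x) \<le> norm y / 2"
      proof (cases "y = 0")
        case True
        then show ?thesis using that[of 0] subspace_0[OF sub] by simp
      next
        case False
        then have "norm y / 2 > 0" by simp
        with y obtain x where "x \<in> ssum M N" "dist x y < norm y / 2"
          by (meson closure_approachable)
        then show ?thesis using that[of x] by (simp add: dist_norm norm_minus_commute)
      qed
      obtain m k where mk: "m \<in> M" "k \<in> N" "x = m + k" "norm m \<le> D * norm x"
        using bd'[OF x(1)] by blast
      \<comment> \<open>Since \<open>x\<close> has norm at most \<open>2 * norm y\<close>, the part
        \<open>m\<close> costs \<open>2 * D\<close> and \<open>k = x - m\<close> another 2; hence
        the constant \<open>2 * D + 2\<close>.\<close>
      have "norm x \<le> norm y + norm (y - x)" using norm_triangle_ineq4[of y "y - x"] by simp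
      then have xn: "norm x \<le> 2 * norm y" using x(2) norm_ge_zero[of y] by linarith
      have Dx: "D * norm x \<le> D * (2 * norm y)" by (rule mult_left_mono[OF xn]) (simp add: D_def)
      have "norm k \<le> norm x + norm m" using mk(3) norm_triangle_ineq4[of x m] by simp
      moreover have "(2 * D + 2) * norm y = D * (2 * norm y) + 2 * norm y" by (simp add: algebra_simps)
      ultimately have m: "norm m \<le> (2 * D + 2) * norm y" and k: "norm k \<le> (2 * D + 2) * norm y"
        using mk(4) xn Dx norm_ge_zero[of y] by linarith+
      have "y - x \<in> closure (ssum M N)"
        unfolding closure_approachable
      proof (intro allI impI)
        fix e :: real assume "e > 0"
        with y obtain z where "z \<in> ssum M N" "dist z y < e" by (meson closure_approachable)
        then show "\<exists>w\<in>ssum M N. dist w (y - x) < e"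
          using subspace_diff[OF sub _ x(1)] by (intro bexI[of _ "z - x"]) (auto simp: dist_norm)
      qed
      then show "\<exists>m\<in>M. \<exists>k\<in>N. y - (m + k) \<in> closure (ssum M N) \<and> norm m \<le> (2 * D + 2) * norm y
         \<and> norm k \<le> (2 * D + 2) * norm y \<and> norm (y - (m + k)) \<le> norm y / 2"
        using mk m k x by blast
    qed
    then show ?thesis by (auto intro: ssumI)
  qed
  then have "closure (ssum M N) \<subseteq> ssum M N" by blast
  then show ?thesis by (simp add: closure_subset_eq)
qed

text \<open>The open mapping argument: \<open>S\<close> is the union of the closures of the
  \<open>U j\<close>, so by Baire one of them has interior. Differences of points near an interior
  point approximate any vector of \<open>S\<close> with summands of controlled size, and successive
  approximation makes this exact.\<close>

lemma closed_imp_bounded_decomp: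
  fixes M N :: "'a::banach set"
  assumes M: "closed_subspace M" and N: "closed_subspace N" and cl: "closed (ssum M N)"
  obtains C where "C \<ge> 0" "bounded_decomp M N C"
proof -
  define S where "S = ssum M N"
  define U where "U = (\<lambda>j::nat. {m + k | m k. m \<in> M \<and> k \<in> N \<and> norm m \<le> j \<and> norm k \<le> j})"
  have sM: "subspace M" and sN: "subspace N" using M N by (auto simp: closed_subspace_def)
  have sS: "subspace S" unfolding S_def by (rule subspace_ssum[OF sM sN])
  have US: "U j \<subseteq> S" for j by (auto simp: U_def S_def ssum_def)
  have AS: "closure (U j) \<subseteq> S" for j using US cl by (simp add: S_def closure_minimal)
  have "x \<in> (\<Union>j. closure (U j))" if "x \<in> S" for x
  proof -
    from that obtain m k where mk: "m \<in> M" "k \<in> N" "x = m + k" unfolding S_def by (rule ssumE)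
    obtain j :: nat where "max (norm m) (norm k) \<le> j" using real_arch_simple by blast
    then have "x \<in> U j" using mk by (auto simp: U_def)
    then show ?thesis using closure_subset by blast
  qed
  then have un: "(\<Union>j. closure (U j)) = S" using AS by blast
  \<comment> \<open>Interiors are relative to \<open>S\<close>, which is completely metrizable as a
    closed subset of a Banach space and is its own nonempty interior.\<close>
  have "\<exists>j. top_of_set S interior_of closure (U j) \<noteq> {}"
  proof (rule ccontr)
    assume "\<not> ?thesis"
    then have "top_of_set S interior_of \<Union>(range (\<lambda>j. closure (U j))) = {}"
      using cl AS
      by (intro Baire_category_alt disjI1 completely_metrizable_space_closedin
            completely_metrizable_space_euclidean)
         (auto simp: S_def closed_subset)
    moreover have "top_of_set S interior_of S = S"
      by (metis interior_of_topspace topspace_euclidean_subtopology)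
    ultimately show False using un subspace_0[OF sS] by auto
  qed
  then obtain j x0 where "x0 \<in> top_of_set S interior_of closure (U j)" by blast
  then obtain T where T: "openin (top_of_set S) T" "x0 \<in> T" "T \<subseteq> closure (U j)"
    by (auto simp: interior_of_def)
  then obtain e where e: "e > 0" "\<And>x. x \<in> S \<Longrightarrow> dist x x0 < e \<Longrightarrow> x \<in> closure (U j)" and x0S: "x0 \<in> S"
    unfolding openin_euclidean_subtopology_iff by (metis subset_iff)
  define C where "C = 4 * real j / e"
  have C0: "C \<ge> 0" using e by (simp add: C_def)
  have "\<exists>m\<in>M. \<exists>k\<in>N. x = m + k \<and> norm m \<le> 2 * C * norm x" if "x \<in> S" for x
  proof (rule approximate_decomposition_imp_exact[OF M N that C0])
    fix y assume y: "y \<in> S"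
    show "\<exists>m\<in>M. \<exists>k\<in>N. y - (m + k) \<in> S \<and> norm m \<le> C * norm y
       \<and> norm k \<le> C * norm y \<and> norm (y - (m + k)) \<le> norm y / 2"
    proof (cases "y = 0")
      case True
      then show ?thesis using subspace_0[OF sM] subspace_0[OF sN] subspace_0[OF sS]
        by (intro bexI[of _ 0]) auto
    next
      case False
      \<comment> \<open>Scaling \<open>y\<close> to norm \<open>e / 2\<close> keeps
        \<open>x0 + t *\<^sub>R y\<close> inside the ball. Two approximations with error
        \<open>e / 8\<close>, subtracted and divided by \<open>t\<close>, leave a residual of at
        most \<open>norm y / 2\<close>, with summands of norm at most
        \<open>2 * j / t = C * norm y\<close>.\<close>
      define t where "t = e / (2 * norm y)"
      have t: "t > 0" using e False by (simp add: t_def)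
      have tn: "norm (t *\<^sub>R y) = e / 2" using e False by (simp add: t_def)
      have "x0 + t *\<^sub>R y \<in> closure (U j)"
        using e tn by (intro e(2) subspace_add[OF sS x0S] subspace_scale[OF sS y]) (simp add: dist_norm)
      moreover have "x0 \<in> closure (U j)" using e x0S by simp
      moreover have "e / 8 > 0" using e by simp
      ultimately obtain a b where a: "a \<in> U j" "dist a (x0 + t *\<^sub>R y) < e / 8"
        and b: "b \<in> U j" "dist b x0 < e / 8" by (meson closure_approachable)
      obtain m1 k1 where 1: "a = m1 + k1" "m1 \<in> M" "k1 \<in> N" "norm m1 \<le> j" "norm k1 \<le> j"
        using a by (auto simp: U_def)
      obtain m2 k2 where 2: "b = m2 + k2" "m2 \<in> M" "k2 \<in> N" "norm m2 \<le> j" "norm k2 \<le> j"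
        using b by (auto simp: U_def)
      define m where "m = (1/t) *\<^sub>R (m1 - m2)"
      define k where "k = (1/t) *\<^sub>R (k1 - k2)"
      have mM: "m \<in> M" and kN: "k \<in> N"
        unfolding m_def k_def using 1 2 sM sN by (auto intro!: subspace_scale subspace_diff)
      have bound: "norm ((1/t) *\<^sub>R (u - v)) \<le> C * norm y" if "norm u \<le> j" "norm v \<le> j" for u v :: 'a
      proof -
        have "norm (u - v) \<le> 2 * real j" using that norm_triangle_ineq4[of u v] by linarith
        then have "(1/t) * norm (u - v) \<le> (1/t) * (2 * real j)" using t by (intro mult_left_mono) auto
        also have "\<dots> = C * norm y" by (simp add: t_def C_def)
        finally show ?thesis using t by simp
      qed
      have "norm (y - (m + k)) = norm ((x0 + t *\<^sub>R y - a) - (x0 - b)) / t"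
      proof -
        have "y - (m + k) = (1/t) *\<^sub>R ((x0 + t *\<^sub>R y - a) - (x0 - b))"
          using t by (simp add: m_def k_def 1 2 algebra_simps)
        then show ?thesis using t by simp
      qed
      moreover have "norm ((x0 + t *\<^sub>R y - a) - (x0 - b)) \<le> e / 4"
        using a(2) b(2) norm_triangle_ineq4[of "x0 + t *\<^sub>R y - a" "x0 - b"]
        by (simp add: dist_norm norm_minus_commute)
      ultimately have "norm (y - (m + k)) \<le> (e / 4) / t"
        using t by (simp only: divide_right_mono less_imp_le)
      also have "\<dots> = norm y / 2" using e by (simp add: t_def)
      finally have "norm (y - (m + k)) \<le> norm y / 2" .
      moreover have "y - (m + k) \<in> S"
        using mM kN y by (intro subspace_diff[OF sS]) (auto simp: S_def intro: ssumI)
      ultimately show ?thesis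
        using mM kN bound[OF 1(4) 2(4)] bound[OF 1(5) 2(5)] unfolding m_def[symmetric] k_def[symmetric]
        by blast
    qed
  qed
  then have "bounded_decomp M N (2 * C)" unfolding bounded_decomp_def S_def by blast
  then show ?thesis using C0 by (intro that[of "2 * C"]) auto
qed

subsection \<open>Finite-dimensional extensions and quotient dimensions\<close>

lemma infdist_less_obtain:
  assumes "infdist y P < r" "P \<noteq> {}"
  obtains z where "z \<in> P" "norm (y - z) < r"
proof -
  have "bdd_below (dist y ` P)" by (rule bdd_belowI[of _ 0]) auto
  then show ?thesis using assms that by (auto simp: infdist_notempty cINF_less_iff dist_norm)
qed

text \<open>Homogeneity of the distance to \<open>Z\<close>. This is how the coefficient of a vector
  far from \<open>Z\<close> is controlled, uniformly in \<open>z\<close>.\<close>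

lemma norm_add_scale_ge:
  fixes w :: "'a::real_normed_vector"
  assumes Z: "subspace Z" and d: "\<And>z. z \<in> Z \<Longrightarrow> d \<le> norm (w - z)" and z: "z \<in> Z"
  shows "\<bar>a\<bar> * d \<le> norm (a *\<^sub>R w + z)"
proof (cases "a = 0")
  case False
  have "d \<le> norm (w - (- (1 / a)) *\<^sub>R z)" by (intro d subspace_scale[OF Z z])
  then have "\<bar>a\<bar> * d \<le> \<bar>a\<bar> * norm (w - (- (1 / a)) *\<^sub>R z)" by (simp add: mult_left_mono)
  also have "\<dots> = norm (a *\<^sub>R (w - (- (1 / a)) *\<^sub>R z))" by simp
  also have "a *\<^sub>R (w - (- (1 / a)) *\<^sub>R z) = a *\<^sub>R w + z" using False by (simp add: algebra_simps)
  finally show ?thesis .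
qed simp

lemma dist_pos_obtain:
  assumes "closed_subspace Z" "v \<notin> Z"
  obtains d where "d > 0" "\<And>z. z \<in> Z \<Longrightarrow> d \<le> norm (v - z)"
proof
  have "Z \<noteq> {}" using assms(1) subspace_0 by (auto simp: closed_subspace_def)
  then show "infdist v Z > 0"
    using assms by (intro infdist_pos_not_in_closed) (auto simp: closed_subspace_def)
  show "infdist v Z \<le> norm (v - z)" if "z \<in> Z" for z
    using infdist_le[OF that] by (simp add: dist_norm)
qed

text \<open>For \<open>v\<close> outside \<open>Z\<close>, the map \<open>(z, a)\<close> to
  \<open>z + a *\<^sub>R v\<close> is bounded below: the distance from \<open>v\<close> to
  \<open>Z\<close> controls \<open>a\<close>, and then \<open>z\<close>. It therefore carries the
  complete space \<open>Z \<times> UNIV\<close> to a complete image.\<close>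

lemma closed_subspace_ssum_span_singleton:
  fixes Z :: "'a::banach set"
  assumes Z: "closed_subspace Z"
  shows "closed_subspace (ssum Z (span {v}))"
proof (cases "v \<in> Z")
  case True
  then have "span {v} \<subseteq> Z" using Z by (simp add: closed_subspace_def span_minimal)
  then have "ssum Z (span {v}) = Z"
    using Z ssum_subset[of Z Z "span {v}"] ssum_superset1[OF subspace_span, of Z "{v}"]
    by (auto simp: closed_subspace_def)
  then show ?thesis using Z by simp
next
  case False
  have sZ: "subspace Z" using Z by (simp add: closed_subspace_def)
  obtain d where d: "d > 0" "\<And>z. z \<in> Z \<Longrightarrow> d \<le> norm (v - z)"
    using dist_pos_obtain[OF Z False] by blast
  define D where "D = 1 / d + (1 + norm v / d)"
  have D: "D > 0" unfolding D_def using d(1) by (intro add_pos_pos add_pos_nonneg) auto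
  define f where "f = (\<lambda>(z::'a, a::real). z + a *\<^sub>R v)"
  have "complete (f ` (Z \<times> UNIV))"
  proof (rule complete_isometric_image)
    show "1 / D > 0" using D by simp
    show "subspace (Z \<times> (UNIV :: real set))" using sZ by (simp add: subspace_Times)
    have "bounded_linear (\<lambda>x::'a \<times> real. fst x + snd x *\<^sub>R v)"
      by (intro bounded_linear_intros)
    then show "bounded_linear f" by (simp add: f_def case_prod_unfold)
    show "complete (Z \<times> (UNIV :: real set))"
      using Z by (simp add: complete_eq_closed closed_Times closed_subspace_def)
    show "\<forall>x\<in>Z \<times> UNIV. norm (f x) \<ge> 1 / D * norm x"
    proof clarify
      fix z and a :: real assume z: "z \<in> Z"
      define u where "u = a *\<^sub>R v + z"
      have a: "\<bar>a\<bar> \<le> norm u / d"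
        using norm_add_scale_ge[OF sZ d(2) z, of a] d(1) by (simp add: u_def field_simps)
      have "norm z \<le> norm u + \<bar>a\<bar> * norm v"
        using norm_triangle_ineq4[of u "a *\<^sub>R v"] by (simp add: u_def)
      also have "\<dots> \<le> norm u + norm u / d * norm v" by (intro add_left_mono mult_right_mono a) simp
      finally have "norm z + \<bar>a\<bar> \<le> D * norm u" using a by (simp add: D_def algebra_simps)
      moreover have "norm (z, a) \<le> norm z + \<bar>a\<bar>" using norm_Pair_le[of z a] by simp
      ultimately have "norm (z, a) \<le> D * norm u" by linarith
      then show "1 / D * norm (z, a) \<le> norm (f (z, a))"
        using D by (simp add: f_def u_def field_simps)
    qed
  qed
  moreover have "f ` (Z \<times> UNIV) = ssum Z (span {v})"
    by (force simp: f_def ssum_def span_singleton image_def)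
  ultimately show ?thesis
    using sZ by (simp add: closed_subspace_def complete_eq_closed subspace_ssum)
qed

lemma closed_subspace_ssum_span:
  fixes Z :: "'a::banach set"
  assumes "finite F" "closed_subspace Z"
  shows "closed_subspace (ssum Z (span F))"
  using assms(1)
proof induction
  case empty
  then show ?case using assms(2) by (simp add: ssum_def)
next
  case (insert v F)
  then show ?case unfolding ssum_span_insert[of Z v F] by (simp add: closed_subspace_ssum_span_singleton)
qed

section \<open>Vectors independent modulo a subspace\<close>

lemma indep_mod_insert:
  assumes Z: "subspace Z" and y: "y \<in> Y" "y \<notin> ssum Z (span F)" and F: "indep_mod F Y Z"
  shows "indep_mod (insert y F) Y Z" "y \<notin> F"
proof -
  have "F \<subseteq> ssum Z (span F)" using span_superset ssum_superset2[OF Z] by blast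
  then show yF: "y \<notin> F" using y by blast
  have fin: "finite F" using F by (simp add: indep_mod_def)
  have "\<forall>f\<in>insert y F. c f = 0" if c: "(\<Sum>f\<in>insert y F. c f *\<^sub>R f) \<in> Z" for c
  proof -
    let ?s = "\<Sum>f\<in>F. c f *\<^sub>R f"
    have s: "?s \<in> span F" by (rule span_sum) (auto intro: span_scale span_base)
    have cZ: "c y *\<^sub>R y + ?s \<in> Z" using c fin yF by simp
    have "c y = 0"
    proof (rule ccontr)
      assume "c y \<noteq> 0"
      then have "y = (1 / c y) *\<^sub>R (c y *\<^sub>R y + ?s) + (- (1 / c y)) *\<^sub>R ?s"
        by (simp add: algebra_simps)
      moreover have "\<dots> \<in> ssum Z (span F)"
        by (intro ssumI subspace_scale[OF Z cZ] span_scale s)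
      ultimately show False using y(2) by simp
    qed
    then show ?thesis using cZ F by (auto simp: indep_mod_def)
  qed
  then show "indep_mod (insert y F) Y Z" using F y fin unfolding indep_mod_def by blast
qed

lemma indep_mod_insertD:
  assumes Z: "subspace Z" and F: "indep_mod (insert v F) Y Z" and v: "v \<notin> F"
  shows "indep_mod F Y Z" "v \<notin> ssum Z (span F)"
proof -
  have fin: "finite F" using F by (simp add: indep_mod_def)
  have ind: "(\<Sum>f\<in>insert v F. c f *\<^sub>R f) \<in> Z \<Longrightarrow> f \<in> insert v F \<Longrightarrow> c f = 0" for c f
    using F by (auto simp: indep_mod_def)
  have upd: "(\<Sum>f\<in>F. (c(v := a)) f *\<^sub>R f) = (\<Sum>f\<in>F. c f *\<^sub>R f)" for c a
    using v by (intro sum.cong) auto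
  have "c f = 0" if "(\<Sum>f\<in>F. c f *\<^sub>R f) \<in> Z" "f \<in> F" for c f
  proof -
    have "(c(v := 0)) f = 0" using that v fin upd[of c 0] by (intro ind) auto
    then show ?thesis using that v by (auto split: if_splits)
  qed
  then show "indep_mod F Y Z" using F by (auto simp: indep_mod_def)
  show "v \<notin> ssum Z (span F)"
  proof
    assume "v \<in> ssum Z (span F)"
    then obtain z s where zs: "z \<in> Z" "s \<in> span F" "v = z + s" by (rule ssumE)
    then obtain c where c: "s = (\<Sum>f\<in>F. c f *\<^sub>R f)" using fin by (auto simp: span_finite)
    have "(\<Sum>f\<in>insert v F. (c(v := -1)) f *\<^sub>R f) = - z"
      using fin v upd[of c "-1"] zs c by simp
    then have "(c(v := -1)) v = 0" using subspace_neg[OF Z zs(1)] by (intro ind) auto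
    then show False by simp
  qed
qed

text \<open>Induction on \<open>F\<close>: the distance from the newest vector to the closed
  subspace \<open>ssum Z (span F)\<close> bounds its coefficient. Removing its contribution leaves a
  vector to which the bound for the smaller family applies.\<close>

lemma indep_mod_coeff_bound:
  fixes Z :: "'a::banach set"
  assumes Z: "closed_subspace Z" and F: "indep_mod F Y Z"
  shows "\<exists>C\<ge>0. \<forall>c. \<forall>z\<in>Z. (\<Sum>f\<in>F. \<bar>c f\<bar>) \<le> C * norm ((\<Sum>f\<in>F. c f *\<^sub>R f) + z)"
proof -
  have sZ: "subspace Z" using Z by (simp add: closed_subspace_def)
  have "finite F" using F by (simp add: indep_mod_def)
  then show ?thesis using F
  proof induction
    case (insert v F)
    note D = indep_mod_insertD[OF sZ insert.prems insert.hyps(2)]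
    obtain C where C: "C \<ge> 0"
      "\<And>c z. z \<in> Z \<Longrightarrow> (\<Sum>f\<in>F. \<bar>c f\<bar>) \<le> C * norm ((\<Sum>f\<in>F. c f *\<^sub>R f) + z)"
      using insert.IH[OF D(1)] by auto
    have P: "closed_subspace (ssum Z (span F))"
      using insert.hyps Z by (simp add: closed_subspace_ssum_span)
    obtain d where d: "d > 0" "\<And>z. z \<in> ssum Z (span F) \<Longrightarrow> d \<le> norm (v - z)"
      using dist_pos_obtain[OF P D(2)] by blast
    have "(\<Sum>f\<in>insert v F. \<bar>c f\<bar>)
        \<le> (1 / d + C * (1 + norm v / d)) * norm ((\<Sum>f\<in>insert v F. c f *\<^sub>R f) + z)"
      if z: "z \<in> Z" for c z
    proof -
      define s where "s = (\<Sum>f\<in>F. c f *\<^sub>R f)"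
      define u where "u = c v *\<^sub>R v + (s + z)"
      have "s \<in> span F" unfolding s_def by (rule span_sum) (auto intro: span_scale span_base)
      then have "s + z \<in> ssum Z (span F)" using ssumI[OF z] by (simp add: add.commute)
      then have "\<bar>c v\<bar> * d \<le> norm u" unfolding u_def
        using P d(2) by (intro norm_add_scale_ge) (auto simp: closed_subspace_def)
      then have cv: "\<bar>c v\<bar> \<le> norm u / d" using d(1) by (simp add: field_simps)
      have "norm (s + z) \<le> norm u + \<bar>c v\<bar> * norm v"
        using norm_triangle_ineq4[of u "c v *\<^sub>R v"] by (simp add: u_def)
      also have "\<dots> \<le> norm u + norm u / d * norm v" by (intro add_left_mono mult_right_mono cv) simp
      finally have "C * norm (s + z) \<le> C * (norm u + norm u / d * norm v)"
        using C(1) by (rule mult_left_mono)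
      then have "\<bar>c v\<bar> + (\<Sum>f\<in>F. \<bar>c f\<bar>) \<le> norm u / d + C * (norm u + norm u / d * norm v)"
        using C(2)[OF z, of c] cv unfolding s_def[symmetric] by linarith
      then show ?thesis using insert.hyps by (simp add: s_def u_def algebra_simps)
    qed
    moreover have "1 / d + C * (1 + norm v / d) \<ge> 0" using C(1) d(1) by simp
    ultimately show ?case by blast
  qed (auto intro: exI[of _ 0])
qed

text \<open>An indexed form of the exchange bound. Repetitions are possible, and two equal members
  already give the relation with coefficients 1 and -1.\<close>

lemma dependent_family:
  fixes f :: "'i \<Rightarrow> 'a::real_vector"
  assumes F: "finite F" and I: "finite I" and card: "card F < card I"
    and f: "\<And>i. i \<in> I \<Longrightarrow> f i \<in> span F"
  shows "\<exists>c. (\<exists>i\<in>I. c i \<noteq> 0) \<and> (\<Sum>i\<in>I. c i *\<^sub>R f i) = 0"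
proof (cases "inj_on f I")
  case True
  have "dependent (f ` I)"
    using independent_span_bound[OF F, of "f ` I"] f card card_image[OF True] by fastforce
  then obtain u where u: "\<exists>v\<in>f ` I. u v \<noteq> 0" "(\<Sum>v\<in>f ` I. u v *\<^sub>R v) = 0"
    using I by (auto simp: dependent_finite)
  then show ?thesis by (intro exI[of _ "u \<circ> f"]) (auto simp: sum.reindex[OF True])
next
  case False
  then obtain i j where ij: "i \<in> I" "j \<in> I" "i \<noteq> j" "f i = f j" by (auto simp: inj_on_def)
  define c where "c = (\<lambda>k. if k = i then 1 else if k = j then -1 else (0::real))"
  have "(\<Sum>k\<in>I. c k *\<^sub>R f k) = (\<Sum>k\<in>{i, j}. c k *\<^sub>R f k)"
    using ij I by (intro sum.mono_neutral_right) (auto simp: c_def)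
  also have "\<dots> = 0" using ij by (simp add: c_def)
  finally show ?thesis using ij by (intro exI[of _ c]) (auto simp: c_def)
qed

text \<open>A linear relation among the \<open>span W\<close> components of the vectors of
  \<open>G\<close> puts the same combination of the vectors themselves into
  \<open>Z\<close>.\<close>

lemma card_indep_mod_le:
  assumes Z: "subspace Z" and Y: "Y \<subseteq> ssum Z (span W)" and W: "finite W" and G: "indep_mod G Y Z"
  shows "card G \<le> card W"
proof (rule ccontr)
  assume less: "\<not> card G \<le> card W"
  have finG: "finite G" and GY: "G \<subseteq> Y" using G by (auto simp: indep_mod_def)
  have "\<exists>z s. z \<in> Z \<and> s \<in> span W \<and> g = z + s" if "g \<in> G" for g
    using that GY Y by (blast elim: ssumE)
  then obtain z s where zs: "\<And>g. g \<in> G \<Longrightarrow> z g \<in> Z \<and> s g \<in> span W \<and> g = z g + s g" by metis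
  obtain c where c: "\<exists>g\<in>G. c g \<noteq> 0" "(\<Sum>g\<in>G. c g *\<^sub>R s g) = 0"
    using dependent_family[OF W finG, of s] zs less by auto
  have "(\<Sum>g\<in>G. c g *\<^sub>R g) = (\<Sum>g\<in>G. c g *\<^sub>R z g + c g *\<^sub>R s g)"
    using zs by (intro sum.cong) (auto simp flip: scaleR_add_right)
  also have "\<dots> = (\<Sum>g\<in>G. c g *\<^sub>R z g)" using c(2) by (simp add: sum.distrib)
  also have "\<dots> \<in> Z" using zs by (intro subspace_sum[OF Z] subspace_scale[OF Z]) auto
  finally show False using G c(1) by (auto simp: indep_mod_def)
qed

text \<open>An independent family of greatest size represents a basis of the quotient, since any
  vector of \<open>Y\<close> that it misses would enlarge it.\<close>

lemma qdim_finite_obtain: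
  assumes Z: "subspace Z" and fin: "qdim Y Z \<noteq> \<infinity>"
  obtains F where "indep_mod F Y Z" "qdim Y Z = enat (card F)" "Y \<subseteq> ssum Z (span F)"
proof -
  obtain n where n: "qdim Y Z = enat n" using fin by auto
  have le: "card F \<le> n" if "indep_mod F Y Z" for F
  proof -
    have "enat (card F) \<le> qdim Y Z" unfolding qdim_def using that by (intro SUP_upper) simp
    then show ?thesis using n by simp
  qed
  have "indep_mod {} Y Z" by (simp add: indep_mod_def)
  then have "\<exists>F. indep_mod F Y Z \<and> (\<forall>G. indep_mod G Y Z \<longrightarrow> card G \<le> card F)"
    by (rule ex_has_greatest_nat[where b = "Suc n"]) (auto simp: less_Suc_eq_le le)
  then obtain F where F: "indep_mod F Y Z" "\<And>G. indep_mod G Y Z \<Longrightarrow> card G \<le> card F" by blast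
  have "Y \<subseteq> ssum Z (span F)"
  proof (rule ccontr)
    assume "\<not> ?thesis"
    then obtain y where y: "y \<in> Y" "y \<notin> ssum Z (span F)" by blast
    note I = indep_mod_insert[OF Z y F(1)]
    have "finite F" using F(1) by (simp add: indep_mod_def)
    then show False using F(2)[OF I(1)] I(2) by simp
  qed
  moreover have "qdim Y Z = enat (card F)"
  proof (rule antisym)
    show "qdim Y Z \<le> enat (card F)" unfolding qdim_def using F(2) by (intro SUP_least) simp
    show "enat (card F) \<le> qdim Y Z" unfolding qdim_def using F(1) by (intro SUP_upper) simp
  qed
  ultimately show ?thesis using F(1) that by blast
qed

section \<open>Riesz sequences and the dimension bound\<close>

lemma riesz_lemma:
  fixes P Y :: "'a::real_normed_vector set"
  assumes P: "closed_subspace P" and Y: "subspace Y" and "P \<subseteq> Y" and "\<not> Y \<subseteq> P"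
  obtains x where "x \<in> Y" "norm x \<le> 2" "\<And>z. z \<in> P \<Longrightarrow> 1 \<le> norm (x - z)"
proof -
  obtain y where y: "y \<in> Y" "y \<notin> P" using assms by blast
  have sP: "subspace P" using P by (simp add: closed_subspace_def)
  then have ne: "P \<noteq> {}" using subspace_0 by blast
  define d where "d = infdist y P"
  have d: "d > 0" unfolding d_def
    using P ne y by (intro infdist_pos_not_in_closed) (auto simp: closed_subspace_def)
  then obtain z0 where z0: "z0 \<in> P" "norm (y - z0) < 2 * d"
    using infdist_less_obtain[of y P "2 * d"] ne by (auto simp: d_def)
  \<comment> \<open>Dividing by the distance \<open>d\<close> normalizes the distance to
    \<open>P\<close> to at least 1; the choice of \<open>z0\<close> within \<open>2 * d\<close> then
    gives norm at most 2.\<close>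
  define x where "x = (1 / d) *\<^sub>R (y - z0)"
  have "x \<in> Y" unfolding x_def using y z0 assms by (intro subspace_scale subspace_diff) auto
  moreover have "norm x \<le> 2" using z0 d by (simp add: x_def divide_le_eq)
  moreover have "1 \<le> norm (x - z)" if z: "z \<in> P" for z
  proof -
    have "z0 + d *\<^sub>R z \<in> P" by (intro subspace_add[OF sP] subspace_scale[OF sP] z0 z)
    then have "d \<le> norm (y - (z0 + d *\<^sub>R z))"
      using infdist_le[of "z0 + d *\<^sub>R z" P y] by (simp add: d_def dist_norm)
    also have "y - (z0 + d *\<^sub>R z) = d *\<^sub>R (x - z)" using d by (simp add: x_def algebra_simps)
    finally show ?thesis using d by simp
  qed
  ultimately show ?thesis by (rule that)
qed

text \<open>There are more approximants than elements of \<open>F\<close>, so their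
  \<open>span F\<close> components satisfy a nontrivial relation. The same combination of the
  \<open>v i\<close> lies in \<open>Z\<close> up to an error of \<theta> times the sum of the
  absolute coefficients, which the separation excludes.\<close>

lemma no_large_separated_family:
  fixes v :: "nat \<Rightarrow> 'a::real_normed_vector"
  assumes Z: "subspace Z" and F: "finite F" "card F < n" and \<theta>: "\<theta> * B < 1" and B: "B \<ge> 0"
    and sep: "\<And>c z. z \<in> Z \<Longrightarrow> (\<Sum>i<n. \<bar>c i\<bar>) \<le> B * norm ((\<Sum>i<n. c i *\<^sub>R v i) + z)"
    and near: "\<And>i. i < n \<Longrightarrow> \<exists>w\<in>ssum Z (span F). norm (v i - w) \<le> \<theta>"
  shows False
proof -
  have "\<exists>z s. z \<in> Z \<and> s \<in> span F \<and> norm (v i - (z + s)) \<le> \<theta>" if "i < n" for i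
    using near[OF that] by (auto simp: ssum_def)
  then obtain z s where zs: "\<And>i. i < n \<Longrightarrow> z i \<in> Z \<and> s i \<in> span F \<and> norm (v i - (z i + s i)) \<le> \<theta>"
    by metis
  obtain c where c: "\<exists>i\<in>{..<n}. c i \<noteq> 0" "(\<Sum>i<n. c i *\<^sub>R s i) = 0"
    using dependent_family[OF F(1), of "{..<n}" s] zs F(2) by auto
  have pos: "(\<Sum>i<n. \<bar>c i\<bar>) > 0" using c(1) by (auto intro: sum_pos2)
  have "(\<Sum>i<n. c i *\<^sub>R v i) + (\<Sum>i<n. (- c i) *\<^sub>R z i) = (\<Sum>i<n. c i *\<^sub>R (v i - (z i + s i)))"
    using c(2) by (simp add: algebra_simps sum.distrib sum_subtractf sum_negf)
  also have "norm \<dots> \<le> (\<Sum>i<n. \<bar>c i\<bar> * \<theta>)"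
    using zs by (intro sum_norm_le) (auto intro: mult_left_mono)
  also have "\<dots> = (\<Sum>i<n. \<bar>c i\<bar>) * \<theta>" by (simp add: sum_distrib_right)
  finally have le: "norm ((\<Sum>i<n. c i *\<^sub>R v i) + (\<Sum>i<n. (- c i) *\<^sub>R z i)) \<le> (\<Sum>i<n. \<bar>c i\<bar>) * \<theta>" .
  have "(\<Sum>i<n. (- c i) *\<^sub>R z i) \<in> Z"
    using zs by (intro subspace_sum[OF Z] subspace_scale[OF Z]) auto
  then have "(\<Sum>i<n. \<bar>c i\<bar>) \<le> B * ((\<Sum>i<n. \<bar>c i\<bar>) * \<theta>)"
    using sep[of _ c] mult_left_mono[OF le B] by (meson order_trans)
  also have "\<dots> = (\<Sum>i<n. \<bar>c i\<bar>) * (\<theta> * B)" by simp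
  also have "\<dots> < (\<Sum>i<n. \<bar>c i\<bar>) * 1" using pos \<theta> by (intro mult_strict_left_mono)
  finally show False by simp
qed

text \<open>A larger independent family would allow \<open>card F + 1\<close> applications of the
  Riesz lemma inside \<open>Y\<close>, giving bounded vectors separated modulo \<open>Z\<close>. The
  separation constant is a power of 4 depending on \<open>card F\<close> only, so \<theta> can be
  fixed before \<open>Y\<close> and \<open>Z\<close> are known.\<close>

lemma qdim_le_of_approx:
  fixes Y Z :: "'a::banach set"
  assumes Z: "closed_subspace Z" and Y: "subspace Y" and ZY: "Z \<subseteq> Y" and F: "finite F"
    and \<theta>: "\<theta> * 4 ^ Suc (card F) < 1"
    and near: "\<And>y. y \<in> Y \<Longrightarrow> norm y \<le> 2 \<Longrightarrow> \<exists>w\<in>ssum Z (span F). norm (y - w) \<le> \<theta>"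
  shows "qdim Y Z \<le> enat (card F)"
proof (rule ccontr)
  assume "\<not> ?thesis"
  then have "enat (card F) < (SUP G\<in>{G. indep_mod G Y Z}. enat (card G))" by (simp add: qdim_def)
  then obtain G where G: "indep_mod G Y Z" "card F < card G" by (auto simp: less_SUP_iff)
  have sZ: "subspace Z" using Z by (simp add: closed_subspace_def)
  have "\<exists>v. (\<forall>i<j. v i \<in> Y \<and> norm (v i) \<le> 2) \<and>
      (\<forall>c. \<forall>z\<in>Z. (\<Sum>i<j. \<bar>c i\<bar>) \<le> 4 ^ j * norm ((\<Sum>i<j. c i *\<^sub>R v i) + z))"
    if "j \<le> card G" for j
    using that
  proof (induction j)
    case (Suc j)
    then obtain v where v: "\<And>i. i < j \<Longrightarrow> v i \<in> Y \<and> norm (v i) \<le> 2"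
      and sep: "\<And>c z. z \<in> Z \<Longrightarrow> (\<Sum>i<j. \<bar>c i\<bar>) \<le> 4 ^ j * norm ((\<Sum>i<j. c i *\<^sub>R v i) + z)"
      by auto
    define P where "P = ssum Z (span (v ` {..<j}))"
    have P: "closed_subspace P" unfolding P_def using Z by (simp add: closed_subspace_ssum_span)
    have "P \<subseteq> Y" unfolding P_def using v by (intro ssum_subset Y ZY span_minimal) auto
    \<comment> \<open>Room for another vector: \<open>G\<close> has more than \<open>j\<close>
      elements independent modulo \<open>Z\<close>.\<close>
    moreover have "\<not> Y \<subseteq> P"
    proof
      assume "Y \<subseteq> P"
      then have "card G \<le> card (v ` {..<j})" using G(1) sZ by (intro card_indep_mod_le) (auto simp: P_def)
      also have "\<dots> \<le> j" using card_image_le[of "{..<j}" v] by simp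
      finally show False using Suc.prems by simp
    qed
    ultimately obtain x where x: "x \<in> Y" "norm x \<le> 2" "\<And>z. z \<in> P \<Longrightarrow> 1 \<le> norm (x - z)"
      using riesz_lemma[OF P Y] by blast
    have "(\<Sum>i<Suc j. \<bar>c i\<bar>) \<le> 4 ^ Suc j * norm ((\<Sum>i<Suc j. c i *\<^sub>R (v(j := x)) i) + z)"
      if z: "z \<in> Z" for c z
    proof -
      define s where "s = (\<Sum>i<j. c i *\<^sub>R v i)"
      define u where "u = c j *\<^sub>R x + (s + z)"
      have "s \<in> span (v ` {..<j})" unfolding s_def by (rule span_sum) (auto intro: span_scale span_base)
      then have "s + z \<in> P" unfolding P_def using ssumI[OF z] by (simp add: add.commute)
      \<comment> \<open>As \<open>x\<close> has distance at least 1 from \<open>P\<close>, its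
        coefficient is at most \<open>norm u\<close>, so the remaining part has norm at most
        \<open>3 * norm u\<close>. The old coefficients cost \<open>3 * 4 ^ j\<close> and the new
        one at most \<open>4 ^ j\<close>, together \<open>4 ^ Suc j\<close>.\<close>
      then have cj: "\<bar>c j\<bar> \<le> norm u" unfolding u_def
        using P x(3) norm_add_scale_ge[of P 1 x "s + z" "c j"] by (auto simp: closed_subspace_def)
      have "norm (s + z) \<le> norm u + \<bar>c j\<bar> * norm x"
        using norm_triangle_ineq4[of u "c j *\<^sub>R x"] by (simp add: u_def)
      also have "\<dots> \<le> norm u + norm u * 2" by (intro add_left_mono mult_mono cj x) auto
      finally have "4 ^ j * norm (s + z) \<le> 4 ^ j * (3 * norm u)" by (intro mult_left_mono) auto
      moreover have "1 * norm u \<le> 4 ^ j * norm u" by (intro mult_right_mono) auto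
      ultimately have "(\<Sum>i<j. \<bar>c i\<bar>) + \<bar>c j\<bar> \<le> 4 ^ j * (3 * norm u) + 4 ^ j * norm u"
        using sep[OF z, of c] cj unfolding s_def[symmetric] by linarith
      also have "\<dots> = 4 ^ Suc j * norm u" by simp
      finally have "(\<Sum>i<j. \<bar>c i\<bar>) + \<bar>c j\<bar> \<le> 4 ^ Suc j * norm u" .
      moreover have "(\<Sum>i<j. c i *\<^sub>R (v(j := x)) i) = s" unfolding s_def by (intro sum.cong) auto
      ultimately show ?thesis by (simp add: u_def algebra_simps)
    qed
    moreover have "\<forall>i<Suc j. (v(j := x)) i \<in> Y \<and> norm ((v(j := x)) i) \<le> 2"
      using v x by (auto simp: less_Suc_eq)
    ultimately show ?case by blast
  qed simp
  then have "\<exists>v. (\<forall>i<Suc (card F). v i \<in> Y \<and> norm (v i) \<le> 2) \<and>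
      (\<forall>c. \<forall>z\<in>Z. (\<Sum>i<Suc (card F). \<bar>c i\<bar>)
        \<le> 4 ^ Suc (card F) * norm ((\<Sum>i<Suc (card F). c i *\<^sub>R v i) + z))"
    using G(2) by (simp del: sum.lessThan_Suc power_Suc)
  then obtain v where v: "\<And>i. i < Suc (card F) \<Longrightarrow> v i \<in> Y \<and> norm (v i) \<le> 2"
      and sep: "\<And>c z. z \<in> Z \<Longrightarrow> (\<Sum>i<Suc (card F). \<bar>c i\<bar>)
        \<le> 4 ^ Suc (card F) * norm ((\<Sum>i<Suc (card F). c i *\<^sub>R v i) + z)"
    by blast
  show False
    by (rule no_large_separated_family[OF sZ F lessI \<theta> _ sep]) (use near v in auto)
qed

section \<open>Bounded representations and use of the gap\<close>

lemma indep_mod_bounded_repr: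
  fixes Z :: "'a::banach set"
  assumes Z: "closed_subspace Z" and F: "indep_mod F Y Z" and Y: "Y \<subseteq> ssum Z (span F)"
  obtains D where "D \<ge> 0"
    "\<And>y. y \<in> Y \<Longrightarrow> \<exists>z\<in>Z. \<exists>c. y = z + (\<Sum>f\<in>F. c f *\<^sub>R f) \<and> norm z \<le> D * norm y
       \<and> (\<forall>f\<in>F. \<bar>c f\<bar> \<le> D * norm y)"
proof -
  have fin: "finite F" using F by (simp add: indep_mod_def)
  obtain C where C: "C \<ge> 0"
    "\<And>c z. z \<in> Z \<Longrightarrow> (\<Sum>f\<in>F. \<bar>c f\<bar>) \<le> C * norm ((\<Sum>f\<in>F. c f *\<^sub>R f) + z)"
    using indep_mod_coeff_bound[OF Z F] by auto
  define A where "A = (\<Sum>f\<in>F. norm f)"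
  have A: "A \<ge> 0" by (simp add: A_def sum_nonneg)
  \<comment> \<open>\<open>C\<close> bounds the coefficients, \<open>C * A\<close> the norm of the
    combination and hence \<open>1 + C * A\<close> that of \<open>z\<close>; the sum serves for
    all.\<close>
  define D where "D = C + (1 + C * A)"
  show ?thesis
  proof
    show "D \<ge> 0" using C A by (simp add: D_def)
    fix y assume "y \<in> Y"
    then obtain z s where zs: "z \<in> Z" "s \<in> span F" "y = z + s" using Y by (blast elim: ssumE)
    then obtain c where c: "s = (\<Sum>f\<in>F. c f *\<^sub>R f)" using fin by (auto simp: span_finite)
    have sum: "(\<Sum>f\<in>F. \<bar>c f\<bar>) \<le> C * norm y"
      using C(2)[OF zs(1), of c] zs c by (simp add: add.commute)
    have cf: "\<bar>c f\<bar> \<le> C * norm y" if "f \<in> F" for f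
      using member_le_sum[of f F "\<lambda>f. \<bar>c f\<bar>"] that fin sum by auto
    have "norm s \<le> (\<Sum>f\<in>F. C * norm y * norm f)"
      unfolding c using cf by (intro sum_norm_le) (auto intro: mult_right_mono)
    also have "\<dots> = C * A * norm y" by (simp add: A_def sum_distrib_left mult_ac)
    finally have "norm z \<le> norm y + C * A * norm y"
      using norm_triangle_ineq4[of y s] zs(3) by simp
    moreover have "D * norm y = C * norm y + (norm y + C * A * norm y)"
      by (simp add: D_def algebra_simps)
    moreover have "0 \<le> C * norm y" "0 \<le> C * A * norm y" using C A by auto
    ultimately have "norm z \<le> D * norm y" "C * norm y \<le> D * norm y"
      using norm_ge_zero[of y] by linarith+
    then have "norm z \<le> D * norm y" "\<forall>f\<in>F. \<bar>c f\<bar> \<le> D * norm y"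
      using cf order_trans by blast+
    then show "\<exists>z\<in>Z. \<exists>c. y = z + (\<Sum>f\<in>F. c f *\<^sub>R f) \<and> norm z \<le> D * norm y
       \<and> (\<forall>f\<in>F. \<bar>c f\<bar> \<le> D * norm y)" using zs c by blast
  qed
qed

text \<open>Homogeneous form of a gap estimate. The strict inequality yields an actual
  \<open>b\<close> although the distance need not be attained.\<close>

lemma gap_less_approx:
  assumes A: "subspace A" and B: "subspace B" and gap: "gap A B < \<epsilon>" and u: "u \<in> A"
  shows "\<exists>b\<in>B. norm (u - b) \<le> \<epsilon> * norm u"
proof (cases "u = 0")
  case True
  then show ?thesis using subspace_0[OF B] by (intro bexI[of _ 0]) auto
next
  case False
  define w where "w = (1 / norm u) *\<^sub>R u"
  have w: "w \<in> A" "norm w = 1" using False subspace_scale[OF A u] by (auto simp: w_def)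
  \<comment> \<open>Boundedness makes the real supremum in \<open>gap\<close> an upper bound;
    distances of unit vectors are at most 1 because \<open>B\<close> contains 0.\<close>
  have "bdd_above ((\<lambda>u. infdist u B) ` {u\<in>A. norm u = 1})"
  proof (rule bdd_aboveI2)
    fix v assume "v \<in> {u\<in>A. norm u = 1}"
    then show "infdist v B \<le> 1" using infdist_le[OF subspace_0[OF B], of v] by simp
  qed
  then have "infdist w B \<le> (SUP u\<in>{u\<in>A. norm u = 1}. infdist u B)"
    using w by (intro cSUP_upper) auto
  also have "\<dots> = gap A B" using False u by (auto simp: gap_def)
  finally obtain b where b: "b \<in> B" "norm (w - b) < \<epsilon>"
    using gap infdist_less_obtain[of w B \<epsilon>] subspace_0[OF B] by force
  have "u - norm u *\<^sub>R b = norm u *\<^sub>R (w - b)" using False by (simp add: w_def algebra_simps)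
  then have "norm (u - norm u *\<^sub>R b) \<le> \<epsilon> * norm u"
    using mult_left_mono[OF less_imp_le[OF b(2)] norm_ge_zero[of u]] by (simp add: mult.commute)
  then show ?thesis using subspace_scale[OF B b(1)] by blast
qed

subsection \<open>Closedness when the sum has small codimension\<close>

text \<open>If \<open>v\<close> lies in \<open>ssum M N\<close>, adding it changes nothing.
  Otherwise a splitting of a vector of \<open>ssum M N\<close> in the larger sum cannot involve
  \<open>v\<close>, so the bounded decomposition is inherited.\<close>

lemma closed_ssum_of_singleton_extension:
  fixes M N :: "'a::banach set"
  assumes M: "closed_subspace M" and N: "closed_subspace N"
    and cl: "closed (ssum (ssum M (span {v})) N)"
  shows "closed (ssum M N)"
proof -
  have sM: "subspace M" and sN: "subspace N" using M N by (auto simp: closed_subspace_def)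
  have sMN: "subspace (ssum M N)" by (rule subspace_ssum[OF sM sN])
  have eq: "ssum (ssum M (span {v})) N = ssum (ssum M N) (span {v})"
    by (simp add: ssum_assoc ssum_commute[of N])
  show ?thesis
  proof (cases "v \<in> ssum M N")
    case True
    then have "span {v} \<subseteq> ssum M N" using sMN by (simp add: span_minimal)
    then have "ssum (ssum M N) (span {v}) = ssum M N"
      using ssum_subset[OF sMN order_refl] ssum_superset1[OF subspace_span] by blast
    then show ?thesis using cl eq by simp
  next
    case False
    obtain C where C: "bounded_decomp (ssum M (span {v})) N C"
      using closed_imp_bounded_decomp[OF closed_subspace_ssum_span_singleton[OF M] N cl] by blast
    have "bounded_decomp M N C"
      unfolding bounded_decomp_def
    proof
      fix x assume x: "x \<in> ssum M N"
      then have "x \<in> ssum (ssum M (span {v})) N"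
        unfolding eq using ssum_superset1[OF subspace_span] by blast
      then obtain m1 k where 1: "m1 \<in> ssum M (span {v})" "k \<in> N" "x = m1 + k" "norm m1 \<le> C * norm x"
        using C unfolding bounded_decomp_def by blast
      obtain m a where m: "m \<in> M" "m1 = m + a *\<^sub>R v" using ssum_span_singletonE[OF 1(1)] by blast
      have av: "a *\<^sub>R v \<in> ssum M N"
        using subspace_diff[OF sMN x ssumI[OF m(1) 1(2)]] m 1 by simp
      have "a = 0"
      proof (rule ccontr)
        assume "a \<noteq> 0"
        then show False using subspace_scale[OF sMN av, of "1 / a"] False by simp
      qed
      then show "\<exists>m\<in>M. \<exists>k\<in>N. x = m + k \<and> norm m \<le> C * norm x" using m 1 by auto
    qed
    then show ?thesis by (rule bounded_decomp_imp_closed[OF M N])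
  qed
qed

lemma closed_ssum_of_finite_extension:
  fixes M N :: "'a::banach set"
  assumes V: "finite V" and M: "closed_subspace M" and N: "closed_subspace N"
    and cl: "closed (ssum (ssum M (span V)) N)"
  shows "closed (ssum M N)"
  using V cl
proof induction
  case empty
  then show ?case by (simp add: ssum_def)
next
  case (insert v V)
  from insert.prems have "closed (ssum (ssum (ssum M (span V)) (span {v})) N)"
    unfolding ssum_span_insert[of M v V] .
  then have "closed (ssum (ssum M (span V)) N)"
    by (rule closed_ssum_of_singleton_extension[OF closed_subspace_ssum_span[OF insert.hyps(1) M] N])
  then show ?case by (rule insert.IH)
qed

text \<open>By induction such a set is the Minkowski sum of a compact segment and the corresponding
  set for the smaller family.\<close>

lemma compact_bounded_combinations:
  fixes F :: "'a::real_normed_vector set"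
  assumes "finite F"
  shows "compact {(\<Sum>f\<in>F. a f *\<^sub>R f) | a. \<forall>f\<in>F. \<bar>a f\<bar> \<le> R}"
  using assms
proof induction
  case (insert v F)
  let ?K = "{(\<Sum>f\<in>F. a f *\<^sub>R f) | a. \<forall>f\<in>F. \<bar>a f\<bar> \<le> R}"
  have eq: "{(\<Sum>f\<in>insert v F. a f *\<^sub>R f) | a. \<forall>f\<in>insert v F. \<bar>a f\<bar> \<le> R}
      = {x + y | x y. x \<in> (\<lambda>t. t *\<^sub>R v) ` {-R..R} \<and> y \<in> ?K}" (is "?A = ?B")
  proof (intro set_eqI iffI)
    fix x assume "x \<in> ?A"
    then obtain a where "x = a v *\<^sub>R v + (\<Sum>f\<in>F. a f *\<^sub>R f)" "\<forall>f\<in>insert v F. \<bar>a f\<bar> \<le> R"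
      using insert.hyps by auto
    then show "x \<in> ?B" by (force simp: abs_le_iff)
  next
    fix x assume "x \<in> ?B"
    then obtain t a where x: "x = t *\<^sub>R v + (\<Sum>f\<in>F. a f *\<^sub>R f)" "t \<in> {-R..R}" "\<forall>f\<in>F. \<bar>a f\<bar> \<le> R"
      by auto
    have "(\<Sum>f\<in>F. (a(v := t)) f *\<^sub>R f) = (\<Sum>f\<in>F. a f *\<^sub>R f)"
      using insert.hyps by (intro sum.cong) auto
    then have "x = (\<Sum>f\<in>insert v F. (a(v := t)) f *\<^sub>R f)" using insert.hyps x by simp
    then show "x \<in> ?A" using x by (intro CollectI exI[of _ "a(v := t)"]) (auto simp: abs_le_iff)
  qed
  have "compact ((\<lambda>t. t *\<^sub>R v) ` {-R..R})"
    by (intro compact_continuous_image continuous_intros compact_Icc)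
  then show ?case unfolding eq using insert.IH by (intro compact_sums)
qed simp

text \<open>Covering the compact set of possible finite-dimensional parts by finitely many small balls and
  picking one vector of \<open>Y\<close> per ball turns the approximation by \<open>M + N + span F\<close> into one by
  \<open>M + N + span V\<close> with a finite \<open>V \<subseteq> Y\<close>, which can then be iterated inside \<open>Y\<close>.\<close>

lemma closed_ssum_of_finite_codim_approx:
  fixes M N Y :: "'a::banach set"
  assumes M: "closed_subspace M" and N: "closed_subspace N" and Y: "closed_subspace Y"
    and MN: "ssum M N \<subseteq> Y" and F: "finite F" and R: "R \<ge> 0"
    and near: "\<And>y. y \<in> Y \<Longrightarrow> norm y = 1 \<Longrightarrow> \<exists>m\<in>M. \<exists>k\<in>N. \<exists>a. norm m \<le> R \<and> norm k \<le> R
       \<and> (\<forall>f\<in>F. \<bar>a f\<bar> \<le> R) \<and> norm (y - (m + k + (\<Sum>f\<in>F. a f *\<^sub>R f))) \<le> 1/8"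
  shows "closed (ssum M N)"
proof -
  have sM: "subspace M" and sN: "subspace N" and sY: "subspace Y"
    using M N Y by (auto simp: closed_subspace_def)
  define K where "K = {(\<Sum>f\<in>F. a f *\<^sub>R f) | a. \<forall>f\<in>F. \<bar>a f\<bar> \<le> R}"
  have "compact K" unfolding K_def by (rule compact_bounded_combinations[OF F])
  then obtain P where P: "finite P" "K \<subseteq> (\<Union>p\<in>P. ball p (1/8))"
    unfolding compact_eq_totally_bounded by (meson zero_less_divide_1_iff zero_less_numeral)
  \<comment> \<open>\<open>Q\<close> records that the unit vector \<open>y\<close> of
    \<open>Y\<close> has a bounded splitting whose finite-dimensional part may be replaced by the
    ball centre \<open>p\<close>. The error 1/4 adds the radius 1/8 to the given 1/8.\<close>
  define Q where "Q = (\<lambda>p y m k. y \<in> Y \<and> m \<in> M \<and> k \<in> N \<and> norm y = 1 \<and> norm m \<le> R \<and> norm k \<le> R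
     \<and> norm (y - (m + k + p)) \<le> 1/4)"
  have Qex: "\<exists>p\<in>P. \<exists>m k. Q p y m k" if y: "y \<in> Y" "norm y = 1" for y
  proof -
    obtain m k a where mk: "m \<in> M" "k \<in> N" "norm m \<le> R" "norm k \<le> R" "\<forall>f\<in>F. \<bar>a f\<bar> \<le> R"
      "norm (y - (m + k + (\<Sum>f\<in>F. a f *\<^sub>R f))) \<le> 1/8"
      using near[OF y] by blast
    define s where "s = (\<Sum>f\<in>F. a f *\<^sub>R f)"
    have "s \<in> K" using mk by (auto simp: K_def s_def)
    then obtain p where p: "p \<in> P" "norm (s - p) < 1/8"
      using P by (auto simp: dist_norm norm_minus_commute)
    have "y - (m + k + p) = (y - (m + k + s)) + (s - p)" by simp
    then have "norm (y - (m + k + p)) = norm ((y - (m + k + s)) + (s - p))" by (rule arg_cong)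
    then have "norm (y - (m + k + p)) \<le> 1/4"
      using norm_triangle_ineq[of "y - (m + k + s)" "s - p"] mk(6) p(2) unfolding s_def[symmetric]
      by linarith
    then show ?thesis using mk p y unfolding Q_def by blast
  qed
  define P0 where "P0 = {p \<in> P. \<exists>y m k. Q p y m k}"
  have "\<forall>p\<in>P0. \<exists>y m k. Q p y m k" by (simp add: P0_def)
  then obtain g gm gk where g: "\<And>p. p \<in> P0 \<Longrightarrow> Q p (g p) (gm p) (gk p)" by metis
  define V where "V = g ` P0"
  have V: "finite V" using P by (simp add: V_def P0_def)
  have VY: "V \<subseteq> Y" using g by (auto simp: V_def Q_def)
  define M1 where "M1 = ssum M (span V)"
  have M1: "closed_subspace M1" unfolding M1_def by (rule closed_subspace_ssum_span[OF V M])
  have sM1: "subspace M1" using M1 by (simp add: closed_subspace_def)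
  have "M \<subseteq> Y" "N \<subseteq> Y" using MN ssum_superset1[OF sN, of M] ssum_superset2[OF sM, of N] by blast+
  then have M1Y: "M1 \<subseteq> Y" and NY: "N \<subseteq> Y"
    unfolding M1_def using ssum_subset[OF sY] span_minimal[OF VY sY] by blast+
  define C where "C = 1 + 2 * R"
  have C: "C \<ge> 0" using R by (simp add: C_def)
  have unit: "\<exists>m\<in>M1. \<exists>k\<in>N. norm m \<le> C \<and> norm k \<le> C \<and> norm (y - (m + k)) \<le> 1/2"
    if y: "y \<in> Y" "norm y = 1" for y
  proof -
    \<comment> \<open>\<open>y\<close> and the representative \<open>g p\<close> share the centre
      \<open>p\<close>, so subtracting their splittings cancels \<open>p\<close>, which need not lie
      in \<open>Y\<close>. The errors add to 1/2, and \<open>C = 1 + 2 * R\<close> comes from the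
      unit vector \<open>g p\<close> and two parts of norm at most \<open>R\<close>.\<close>
    obtain p m k where p: "p \<in> P0" and q: "Q p y m k" using Qex[OF y] unfolding P0_def by blast
    have q': "Q p (g p) (gm p) (gk p)" using p by (rule g)
    have "g p \<in> V" using p by (simp add: V_def)
    then have m1: "(m - gm p) + g p \<in> M1" unfolding M1_def
      using q q' by (intro ssumI subspace_diff[OF sM] span_base) (auto simp: Q_def)
    have k1: "k - gk p \<in> N" using q q' by (intro subspace_diff[OF sN]) (auto simp: Q_def)
    have "norm ((m - gm p) + g p) \<le> C"
      using q q' norm_triangle_ineq[of "m - gm p" "g p"] norm_triangle_ineq4[of m "gm p"]
      by (simp add: Q_def C_def)
    moreover have "norm (k - gk p) \<le> C"
      using q q' norm_triangle_ineq4[of k "gk p"] by (simp add: Q_def C_def)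
    moreover have "norm (y - ((m - gm p) + g p + (k - gk p))) \<le> 1/2"
    proof -
      have "y - ((m - gm p) + g p + (k - gk p)) = (y - (m + k + p)) - (g p - (gm p + gk p + p))"
        by simp
      also have "norm \<dots> \<le> norm (y - (m + k + p)) + norm (g p - (gm p + gk p + p))"
        by (rule norm_triangle_ineq4)
      also have "\<dots> \<le> 1/4 + 1/4" using q q' unfolding Q_def by (intro add_mono) blast+
      finally show ?thesis by simp
    qed
    ultimately show ?thesis using m1 k1 by blast
  qed
  have "\<exists>m\<in>M1. \<exists>k\<in>N. y = m + k \<and> norm m \<le> 2 * C * norm y" if "y \<in> Y" for y
  proof (rule approximate_decomposition_imp_exact[OF M1 N that C])
    fix y assume y: "y \<in> Y"
    show "\<exists>m\<in>M1. \<exists>k\<in>N. y - (m + k) \<in> Y \<and> norm m \<le> C * norm y \<and> norm k \<le> C * norm y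
       \<and> norm (y - (m + k)) \<le> norm y / 2"
    proof (cases "y = 0")
      case True
      then show ?thesis using subspace_0[OF sM1] subspace_0[OF sN] subspace_0[OF sY]
        by (intro bexI[of _ 0]) auto
    next
      case False
      obtain m k where mk: "m \<in> M1" "k \<in> N" "norm m \<le> C" "norm k \<le> C"
          "norm ((1 / norm y) *\<^sub>R y - (m + k)) \<le> 1/2"
        using unit[of "(1 / norm y) *\<^sub>R y"] False subspace_scale[OF sY y] by auto
      let ?m = "norm y *\<^sub>R m" and ?k = "norm y *\<^sub>R k"
      have in': "?m \<in> M1" "?k \<in> N" using mk by (auto intro: subspace_scale sM1 sN)
      then have "y - (?m + ?k) \<in> Y" using M1Y NY by (intro subspace_diff[OF sY y] subspace_add[OF sY]) auto
      moreover have "y - (?m + ?k) = norm y *\<^sub>R ((1 / norm y) *\<^sub>R y - (m + k))"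
        using False by (simp add: algebra_simps)
      then have "norm (y - (?m + ?k)) = norm y * norm ((1 / norm y) *\<^sub>R y - (m + k))"
        by (metis norm_scaleR abs_norm_cancel)
      then have "norm (y - (?m + ?k)) \<le> norm y / 2" using mult_left_mono[OF mk(5) norm_ge_zero[of y]] by simp
      moreover have "norm ?m \<le> C * norm y" "norm ?k \<le> C * norm y"
        using mk by (auto simp: mult.commute intro: mult_right_mono)
      ultimately show ?thesis using in' by blast
    qed
  qed
  \<comment> \<open>The residuals stayed in \<open>Y\<close>, so \<open>M1\<close> and
    \<open>N\<close> together fill the closed space \<open>Y\<close>; the finitely many vectors of
    \<open>V\<close> can now be removed again.\<close>
  then have "Y \<subseteq> ssum M1 N" by (metis ssumI subsetI)
  then have "ssum M1 N = Y" using M1Y NY ssum_subset[OF sY] by blast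
  then have "closed (ssum (ssum M (span V)) N)" using Y by (simp add: M1_def closed_subspace_def)
  then show ?thesis by (rule closed_ssum_of_finite_extension[OF V M N])
qed

subsection \<open>Closedness when the intersection has small dimension\<close>

text \<open>A geometric form of the Hahn--Banach theorem; \<open>H\<close> is the kernel of a functional \<open>\<phi>\<close> on \<open>V\<close>
  with \<open>\<phi> w = 1\<close> and norm at most one.\<close>

lemma closed_hyperplane_obtain:
  fixes V Z :: "'a::real_normed_vector set"
  assumes V: "closed_subspace V" and Z: "subspace Z" and ZV: "Z \<subseteq> V" and w: "w \<in> V"
    and far: "\<And>z. z \<in> Z \<Longrightarrow> 1 \<le> norm (w - z)"
  obtains H where "closed_subspace H" "Z \<subseteq> H" "H \<subseteq> V" "V = ssum H (span {w})"
    "\<And>h. h \<in> H \<Longrightarrow> 1 \<le> norm (w - h)"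
proof -
  have sV: "subspace V" using V by (simp add: closed_subspace_def)
  \<comment> \<open>Candidates for the kernel of \<phi>: distance at least 1 from \<open>w\<close>
    says that sending \<open>a *\<^sub>R w + h\<close> to \<open>a\<close> has norm at most
    one.\<close>
  define \<A> where "\<A> = {H. subspace H \<and> Z \<subseteq> H \<and> H \<subseteq> V \<and> (\<forall>h\<in>H. 1 \<le> norm (w - h))}"
  have "\<exists>H\<in>\<A>. \<forall>X\<in>\<A>. H \<subseteq> X \<longrightarrow> X = H"
  proof (rule subset_Zorn_nonempty)
    show "\<A> \<noteq> {}" using Z ZV far by (auto simp: \<A>_def)
    fix \<C> assume ne: "\<C> \<noteq> {}" and ch: "subset.chain \<A> \<C>"
    have CA: "\<C> \<subseteq> \<A>" and lin: "\<And>A B. A \<in> \<C> \<Longrightarrow> B \<in> \<C> \<Longrightarrow> A \<subseteq> B \<or> B \<subseteq> A"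
      using ch by (auto simp: subset.chain_def)
    have "subspace (\<Union>\<C>)"
      unfolding subspace_def
    proof (intro conjI ballI allI)
      obtain A where "A \<in> \<C>" using ne by blast
      then show "0 \<in> \<Union>\<C>" using CA by (auto simp: \<A>_def intro: subspace_0)
      fix x assume x: "x \<in> \<Union>\<C>"
      then obtain A where "A \<in> \<C>" "x \<in> A" by blast
      then have "c *\<^sub>R x \<in> A" for c using CA by (auto simp: \<A>_def intro: subspace_scale)
      then show "c *\<^sub>R x \<in> \<Union>\<C>" for c using \<open>A \<in> \<C>\<close> by blast
      fix y assume "y \<in> \<Union>\<C>"
      with x obtain A where A: "A \<in> \<C>" "x \<in> A" "y \<in> A" using lin by blast
      then have "x + y \<in> A" using CA by (auto simp: \<A>_def intro: subspace_add)
      then show "x + y \<in> \<Union>\<C>" using A by blast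
    qed
    moreover have "Z \<subseteq> \<Union>\<C>" using CA ne unfolding \<A>_def by blast
    ultimately show "\<Union>\<C> \<in> \<A>" using CA by (auto simp: \<A>_def)
  qed
  then obtain H where HA: "H \<in> \<A>" and max: "\<And>X. X \<in> \<A> \<Longrightarrow> H \<subseteq> X \<Longrightarrow> X = H" by blast
  have sH: "subspace H" and ZH: "Z \<subseteq> H" and HV: "H \<subseteq> V" and farH: "\<And>h. h \<in> H \<Longrightarrow> 1 \<le> norm (w - h)"
    using HA by (auto simp: \<A>_def)
  have coeff: "\<bar>a\<bar> \<le> norm (a *\<^sub>R w + h)" if "h \<in> H" for a h
    using norm_add_scale_ge[OF sH farH that, of a] by simp
  have "x \<in> ssum H (span {w})" if x: "x \<in> V" for x
  proof -
    \<comment> \<open>\<open>L\<close> collects the lower bounds that norm one imposes on a value of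
      \<phi> at \<open>x\<close>. They lie below all the upper bounds, so \<open>Sup L\<close> is an
      admissible value.\<close>
    define L where "L = {a - norm (x - (a *\<^sub>R w + h)) | a h. h \<in> H}"
    have ub: "l \<le> b + norm (x - (b *\<^sub>R w + h'))" if "l \<in> L" "h' \<in> H" for l b h'
    proof -
      obtain a h where l: "l = a - norm (x - (a *\<^sub>R w + h))" "h \<in> H" using \<open>l \<in> L\<close> by (auto simp: L_def)
      have "a - b \<le> norm ((a - b) *\<^sub>R w + (h - h'))"
        using coeff[OF subspace_diff[OF sH l(2) that(2)], of "a - b"] by linarith
      also have "(a - b) *\<^sub>R w + (h - h') = (x - (b *\<^sub>R w + h')) - (x - (a *\<^sub>R w + h))"
        by (simp add: algebra_simps)
      also have "norm \<dots> \<le> norm (x - (b *\<^sub>R w + h')) + norm (x - (a *\<^sub>R w + h))"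
        by (rule norm_triangle_ineq4)
      finally show ?thesis using l by simp
    qed
    have L0: "L \<noteq> {}" using subspace_0[OF sH] by (auto simp: L_def)
    have Lb: "bdd_above L" using ub[OF _ subspace_0[OF sH]] by (intro bdd_aboveI) blast
    define \<tau> where "\<tau> = Sup L"
    have \<tau>: "\<bar>\<tau> - a\<bar> \<le> norm (x - (a *\<^sub>R w + h))" if "h \<in> H" for a h
    proof -
      have "a - norm (x - (a *\<^sub>R w + h)) \<le> \<tau>"
        unfolding \<tau>_def using that by (intro cSup_upper Lb) (auto simp: L_def)
      moreover have "\<tau> \<le> a + norm (x - (a *\<^sub>R w + h))"
        unfolding \<tau>_def using that by (intro cSup_least L0 ub)
      ultimately show ?thesis by linarith
    qed
    have xw: "x - \<tau> *\<^sub>R w \<in> V" by (intro subspace_diff[OF sV] subspace_scale[OF sV] x w)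
    \<comment> \<open>With \<tau> as the value at \<open>x\<close>, the vector
      \<open>x - \<tau> *\<^sub>R w\<close> belongs to the kernel. Adjoining it keeps the distance
      from \<open>w\<close>, so maximality puts it into \<open>H\<close>.\<close>
    have "ssum H (span {x - \<tau> *\<^sub>R w}) \<in> \<A>"
    proof -
      have "1 \<le> norm (w - u)" if uin: "u \<in> ssum H (span {x - \<tau> *\<^sub>R w})" for u
      proof -
        obtain h s where u: "h \<in> H" "u = h + s *\<^sub>R (x - \<tau> *\<^sub>R w)" using ssum_span_singletonE[OF uin] by blast
        show ?thesis
        proof (cases "s = 0")
          case True
          then show ?thesis using u farH by simp
        next
          case False
          have "1 = \<bar>s\<bar> * \<bar>\<tau> - (1 / s + \<tau>)\<bar>" using False by (simp flip: abs_mult)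
          also have "\<dots> \<le> \<bar>s\<bar> * norm (x - ((1 / s + \<tau>) *\<^sub>R w + (- (1 / s)) *\<^sub>R h))"
            by (intro mult_left_mono \<tau> subspace_scale[OF sH u(1)]) simp
          also have "\<dots> = norm ((- s) *\<^sub>R (x - ((1 / s + \<tau>) *\<^sub>R w + (- (1 / s)) *\<^sub>R h)))"
            unfolding norm_scaleR by simp
          also have "(- s) *\<^sub>R (x - ((1 / s + \<tau>) *\<^sub>R w + (- (1 / s)) *\<^sub>R h)) = w - u"
            using False u by (simp add: algebra_simps)
          finally show ?thesis .
        qed
      qed
      moreover have "span {x - \<tau> *\<^sub>R w} \<subseteq> V" using xw sV by (simp add: span_minimal)
      ultimately show ?thesis
        using ssum_superset1[OF subspace_span, of H] ZH ssum_subset[OF sV HV] subspace_ssum[OF sH subspace_span]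
        unfolding \<A>_def by blast
    qed
    then have "ssum H (span {x - \<tau> *\<^sub>R w}) = H"
      using ssum_superset1[OF subspace_span] by (intro max)
    then have "x - \<tau> *\<^sub>R w \<in> H"
      using ssum_superset2[OF sH, of "span {x - \<tau> *\<^sub>R w}"] span_base[of "x - \<tau> *\<^sub>R w"] by blast
    then have "(x - \<tau> *\<^sub>R w) + \<tau> *\<^sub>R w \<in> ssum H (span {w})" by (intro ssumI span_scale span_base) auto
    then show ?thesis by simp
  qed
  moreover have "ssum H (span {w}) \<subseteq> V" using w sV by (intro ssum_subset[OF sV HV] span_minimal) auto
  ultimately have VH: "V = ssum H (span {w})" by blast
  \<comment> \<open>The coefficient of \<open>w\<close> in a point of the closure is bounded by its
    distance to every point of \<open>H\<close>, hence vanishes.\<close>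
  have "x \<in> H" if x: "x \<in> closure H" for x
  proof -
    have "x \<in> V" using x HV V closure_minimal unfolding closed_subspace_def by blast
    then obtain h a where ha: "h \<in> H" "x = h + a *\<^sub>R w" using VH ssum_span_singletonE[of x H w] by blast
    have "\<bar>a\<bar> \<le> 0"
    proof (rule field_le_epsilon)
      fix e :: real assume "e > 0"
      with x obtain h' where h': "h' \<in> H" "dist h' x < e" by (meson closure_approachable)
      have "\<bar>a\<bar> \<le> norm (a *\<^sub>R w + (h - h'))" by (intro coeff subspace_diff[OF sH] ha h')
      also have "a *\<^sub>R w + (h - h') = x - h'" using ha by simp
      finally show "\<bar>a\<bar> \<le> 0 + e" using h' by (simp add: dist_norm norm_minus_commute)
    qed
    then show ?thesis using ha by simp
  qed
  then have "closed H" by (metis closure_subset_eq subsetI)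
  then show ?thesis using that[of H] sH ZH HV VH farH by (simp add: closed_subspace_def)
qed

text \<open>The possible \<open>M\<close>-parts of a vector \<open>x\<close> form a coset of
  \<open>M \<inter> N\<close>. If all are large compared with \<open>x\<close>, then
  \<open>m\<close> is far from \<open>M \<inter> N\<close>, and rescaling as in the Riesz lemma
  gives a vector far from the intersection yet nearly in \<open>N\<close>.\<close>

lemma not_bounded_decomp_obtain:
  fixes M N :: "'a::real_normed_vector set"
  assumes M: "subspace M" and N: "subspace N" and nb: "\<not> bounded_decomp M N (1 / \<eta>)" and \<eta>: "\<eta> > 0"
  obtains w k where "w \<in> M" "k \<in> N" "norm w \<le> 2" "norm (w + k) \<le> \<eta>"
    "\<And>z. z \<in> M \<inter> N \<Longrightarrow> 1 \<le> norm (w - z)"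
proof -
  obtain x where x: "x \<in> ssum M N" "\<And>m k. m \<in> M \<Longrightarrow> k \<in> N \<Longrightarrow> x = m + k \<Longrightarrow> norm x / \<eta> < norm m"
    using nb by (force simp: bounded_decomp_def)
  obtain m k where mk: "m \<in> M" "k \<in> N" "x = m + k" using x(1) by (rule ssumE)
  have sub: "subspace (M \<inter> N)" using M N by (rule subspace_inter)
  have ne: "M \<inter> N \<noteq> {}" using subspace_0[OF sub] by blast
  define d where "d = infdist m (M \<inter> N)"
  have xd: "norm x / \<eta> \<le> d"
    unfolding d_def infdist_notempty[OF ne]
  proof (rule cINF_greatest[OF ne])
    fix z assume z: "z \<in> M \<inter> N"
    then have "norm x / \<eta> < norm (m - z)"
      using mk by (intro x(2)[of _ "k + z"] subspace_diff[OF M] subspace_add[OF N]) auto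
    then show "norm x / \<eta> \<le> dist m z" by (simp add: dist_norm)
  qed
  \<comment> \<open>The zero vector splits as \<open>0 + 0\<close>. This makes the scaling factor
    \<open>d\<close> positive.\<close>
  have "x \<noteq> 0" using x(2)[OF subspace_0[OF M] subspace_0[OF N]] by auto
  then have "norm x / \<eta> > 0" using \<eta> by simp
  then have d: "d > 0" using xd by linarith
  then obtain z0 where z0: "z0 \<in> M \<inter> N" "norm (m - z0) < 2 * d"
    using infdist_less_obtain[of m "M \<inter> N" "2 * d"] ne by (auto simp: d_def)
  define w where "w = (1 / d) *\<^sub>R (m - z0)"
  define l where "l = (1 / d) *\<^sub>R (k + z0)"
  show ?thesis
  proof
    show "w \<in> M" "l \<in> N" unfolding w_def l_def
      using mk z0 M N by (auto intro!: subspace_scale subspace_diff subspace_add)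
    show "norm w \<le> 2" using z0 d by (simp add: w_def divide_le_eq)
    have "w + l = (1 / d) *\<^sub>R x" using mk(3) by (simp add: w_def l_def algebra_simps)
    then show "norm (w + l) \<le> \<eta>" using xd d \<eta> by (simp add: field_simps)
    fix z assume z: "z \<in> M \<inter> N"
    have "z0 + d *\<^sub>R z \<in> M \<inter> N" by (intro subspace_add[OF sub] subspace_scale[OF sub] z0 z)
    then have "d \<le> norm (m - (z0 + d *\<^sub>R z))"
      using infdist_le[of "z0 + d *\<^sub>R z" "M \<inter> N" m] by (simp add: d_def dist_norm)
    also have "m - (z0 + d *\<^sub>R z) = d *\<^sub>R (w - z)" using d by (simp add: w_def algebra_simps)
    finally show "1 \<le> norm (w - z)" using d by simp
  qed
qed

text \<open>The induction keeps a closed \<open>H\<close> containing \<open>M \<inter> N\<close>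
  with \<open>ssum H N\<close> not closed, and separation modulo \<open>H\<close>. The next vector
  is found in \<open>H\<close>, which then shrinks to a hyperplane far from that vector; a closed
  sum for the hyperplane would stay closed after adding the line back.\<close>

lemma closed_ssum_of_finite_dim_approx:
  fixes M N :: "'a::banach set"
  assumes M: "closed_subspace M" and N: "closed_subspace N" and F: "finite F" and \<eta>: "\<eta> > 0"
    and \<theta>: "\<theta> * 4 ^ Suc (card F) < 1"
    and near: "\<And>m k. m \<in> M \<Longrightarrow> k \<in> N \<Longrightarrow> norm m \<le> 2 \<Longrightarrow> norm (m + k) \<le> \<eta> \<Longrightarrow>
       \<exists>w\<in>ssum (M \<inter> N) (span F). norm (m - w) \<le> \<theta>"
  shows "closed (ssum M N)"
proof (rule ccontr)
  assume ncl: "\<not> closed (ssum M N)"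
  have sM: "subspace M" and sN: "subspace N" using M N by (auto simp: closed_subspace_def)
  have sZ: "subspace (M \<inter> N)" using sM sN by (rule subspace_inter)
  have "\<exists>v H. closed_subspace H \<and> M \<inter> N \<subseteq> H \<and> H \<subseteq> M \<and> \<not> closed (ssum H N) \<and>
      (\<forall>i<j. v i \<in> M \<and> norm (v i) \<le> 2 \<and> (\<exists>k\<in>N. norm (v i + k) \<le> \<eta>)) \<and>
      (\<forall>c. \<forall>z\<in>H. (\<Sum>i<j. \<bar>c i\<bar>) \<le> 4 ^ j * norm ((\<Sum>i<j. c i *\<^sub>R v i) + z))" for j :: nat
  proof (induction j)
    case 0
    show ?case using M ncl by (intro exI[of _ "\<lambda>_. 0"] exI[of _ M]) auto
  next
    case (Suc j)
    then obtain v H where H: "closed_subspace H" "M \<inter> N \<subseteq> H" "H \<subseteq> M" "\<not> closed (ssum H N)"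
      and v: "\<And>i. i < j \<Longrightarrow> v i \<in> M \<and> norm (v i) \<le> 2 \<and> (\<exists>k\<in>N. norm (v i + k) \<le> \<eta>)"
      and sep: "\<And>c z. z \<in> H \<Longrightarrow> (\<Sum>i<j. \<bar>c i\<bar>) \<le> 4 ^ j * norm ((\<Sum>i<j. c i *\<^sub>R v i) + z)"
      by blast
    have sH: "subspace H" using H by (simp add: closed_subspace_def)
    have "\<not> bounded_decomp H N (1 / \<eta>)" using bounded_decomp_imp_closed[OF H(1) N] H(4) by blast
    then obtain x k where x: "x \<in> H" "k \<in> N" "norm x \<le> 2" "norm (x + k) \<le> \<eta>"
      and xfar: "\<And>z. z \<in> H \<inter> N \<Longrightarrow> 1 \<le> norm (x - z)"
      using not_bounded_decomp_obtain[OF sH sN _ \<eta>] by blast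
    have HN: "M \<inter> N \<subseteq> H \<inter> N" using H by blast
    obtain H' where H': "closed_subspace H'" "M \<inter> N \<subseteq> H'" "H' \<subseteq> H" "H = ssum H' (span {x})"
      "\<And>h. h \<in> H' \<Longrightarrow> 1 \<le> norm (x - h)"
      using closed_hyperplane_obtain[OF H(1) sZ H(2) x(1)] xfar HN by blast
    have sH': "subspace H'" using H' by (simp add: closed_subspace_def)
    have "\<not> closed (ssum H' N)"
    proof
      assume "closed (ssum H' N)"
      then have "closed_subspace (ssum (ssum H' N) (span {x}))"
        by (intro closed_subspace_ssum_span_singleton) (simp add: closed_subspace_def subspace_ssum sH' sN)
      moreover have "ssum (ssum H' N) (span {x}) = ssum H N"
        by (simp add: H'(4) ssum_assoc ssum_commute[of N])
      ultimately show False using H(4) by (simp add: closed_subspace_def)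
    qed
    moreover have "(\<Sum>i<Suc j. \<bar>c i\<bar>) \<le> 4 ^ Suc j * norm ((\<Sum>i<Suc j. c i *\<^sub>R (v(j := x)) i) + z)"
      if z: "z \<in> H'" for c z
    proof -
      define s where "s = (\<Sum>i<j. c i *\<^sub>R v i)"
      define u where "u = s + (c j *\<^sub>R x + z)"
      \<comment> \<open>The new vector lies in \<open>H\<close>, so the old separation bounds the
        old coefficients first, by \<open>4 ^ j * norm u\<close>. Distance from \<open>H'\<close>
        then bounds the last one by \<open>norm u + norm s\<close>, and the total is at most
        \<open>(1 + 3 * 4 ^ j) * norm u\<close>.\<close>
      have "c j *\<^sub>R x + z \<in> H" using H' z x by (intro subspace_add[OF sH] subspace_scale[OF sH]) auto
      then have 1: "(\<Sum>i<j. \<bar>c i\<bar>) \<le> 4 ^ j * norm u" using sep by (simp add: u_def s_def)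
      have "norm s \<le> (\<Sum>i<j. \<bar>c i\<bar> * 2)"
        unfolding s_def using v by (intro sum_norm_le) (auto intro: mult_left_mono)
      also have "\<dots> = 2 * (\<Sum>i<j. \<bar>c i\<bar>)" by (simp add: sum_distrib_left mult.commute)
      finally have "norm s \<le> 2 * (\<Sum>i<j. \<bar>c i\<bar>)" .
      moreover have "\<bar>c j\<bar> \<le> norm (c j *\<^sub>R x + z)"
        using norm_add_scale_ge[OF sH' H'(5) z, of "c j"] by simp
      moreover have "norm (c j *\<^sub>R x + z) \<le> norm u + norm s"
        using norm_triangle_ineq4[of u s] by (simp add: u_def)
      moreover have "1 * norm u \<le> 4 ^ j * norm u" by (intro mult_right_mono) auto
      ultimately have "(\<Sum>i<j. \<bar>c i\<bar>) + \<bar>c j\<bar> \<le> 4 * (4 ^ j * norm u)" using 1 by linarith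
      moreover have "(\<Sum>i<j. c i *\<^sub>R (v(j := x)) i) = s" unfolding s_def by (intro sum.cong) auto
      ultimately show ?thesis by (simp add: u_def algebra_simps)
    qed
    moreover have "\<forall>i<Suc j. (v(j := x)) i \<in> M \<and> norm ((v(j := x)) i) \<le> 2
        \<and> (\<exists>k\<in>N. norm ((v(j := x)) i + k) \<le> \<eta>)"
      using v x H(3) by (auto simp: less_Suc_eq)
    ultimately show ?case using H' H(3)
      by (intro exI[of _ "v(j := x)"] exI[of _ H'] conjI allI ballI) auto
  qed
  from this[of "Suc (card F)"] obtain v
    where v: "\<And>i. i < Suc (card F) \<Longrightarrow> v i \<in> M \<and> norm (v i) \<le> 2 \<and> (\<exists>k\<in>N. norm (v i + k) \<le> \<eta>)"
      and sep: "\<And>c z. z \<in> M \<inter> N \<Longrightarrow> (\<Sum>i<Suc (card F). \<bar>c i\<bar>)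
        \<le> 4 ^ Suc (card F) * norm ((\<Sum>i<Suc (card F). c i *\<^sub>R v i) + z)"
    by blast
  show False
  proof (rule no_large_separated_family[OF sZ F lessI \<theta> _ sep])
    show "\<exists>w\<in>ssum (M \<inter> N) (span F). norm (v i - w) \<le> \<theta>" if "i < Suc (card F)" for i
      using v[OF that] near by blast
  qed auto
qed

subsection \<open>Semicontinuity\<close>

text \<open>A vector of \<open>Y2'\<close> is moved into \<open>Y2\<close>, split there along
  \<open>M\<close>, \<open>N\<close> and \<open>span F\<close> with bounds, and the first two parts
  are moved to \<open>M'\<close> and \<open>N'\<close>. The same \<open>F\<close> serves every
  perturbation.\<close>

lemma semicontinuity_codim:
  fixes M N Y2 :: "'a::banach set"
  assumes M: "closed_subspace M" and N: "closed_subspace N" and Y2: "closed_subspace Y2"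
    and cl: "closed (ssum M N)" and fin: "qdim Y2 (ssum M N) \<noteq> \<infinity>"
  shows "\<exists>\<epsilon>>0. \<forall>M' N' Y2'. closed_subspace M' \<and> closed_subspace N' \<and> closed_subspace Y2'
         \<and> ssum M' N' \<subseteq> Y2'
         \<and> gap M M' < \<epsilon> \<and> gap N N' < \<epsilon> \<and> gap Y2' Y2 < \<epsilon>
         \<longrightarrow> closed (ssum M' N') \<and> qdim Y2' (ssum M' N') \<le> qdim Y2 (ssum M N)"
proof -
  have sM: "subspace M" and sN: "subspace N" and sY: "subspace Y2"
    using M N Y2 by (auto simp: closed_subspace_def)
  have MN: "closed_subspace (ssum M N)" using cl subspace_ssum[OF sM sN] by (simp add: closed_subspace_def)
  obtain F where F: "indep_mod F Y2 (ssum M N)" "qdim Y2 (ssum M N) = enat (card F)"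
      "Y2 \<subseteq> ssum (ssum M N) (span F)"
    using qdim_finite_obtain[OF subspace_ssum[OF sM sN] fin] by blast
  have finF: "finite F" using F(1) by (simp add: indep_mod_def)
  obtain D1 where D1: "D1 \<ge> 0" "\<And>y. y \<in> Y2 \<Longrightarrow> \<exists>z\<in>ssum M N. \<exists>c. y = z + (\<Sum>f\<in>F. c f *\<^sub>R f)
       \<and> norm z \<le> D1 * norm y \<and> (\<forall>f\<in>F. \<bar>c f\<bar> \<le> D1 * norm y)"
    using indep_mod_bounded_repr[OF MN F(1,3)] by blast
  obtain C where C: "C \<ge> 0" "bounded_decomp M N C"
    using closed_imp_bounded_decomp[OF M N cl] by blast
  define D where "D = (1 + C) * D1"
  have D: "D \<ge> 0" using C D1 by (simp add: D_def)
  have repr: "\<exists>m\<in>M. \<exists>k\<in>N. \<exists>c. y = m + k + (\<Sum>f\<in>F. c f *\<^sub>R f) \<and> norm m \<le> D * norm y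
      \<and> norm k \<le> D * norm y \<and> (\<forall>f\<in>F. \<bar>c f\<bar> \<le> D * norm y)" if y: "y \<in> Y2" for y
  proof -
    obtain z c where z: "z \<in> ssum M N" "y = z + (\<Sum>f\<in>F. c f *\<^sub>R f)" "norm z \<le> D1 * norm y"
      "\<forall>f\<in>F. \<bar>c f\<bar> \<le> D1 * norm y"
      using D1(2)[OF y] by blast
    obtain m k where mk: "m \<in> M" "k \<in> N" "z = m + k" "norm m \<le> C * norm z"
      using C(2) z(1) unfolding bounded_decomp_def by blast
    have Cz: "C * norm z \<le> C * (D1 * norm y)" using z(3) C(1) by (rule mult_left_mono)
    have "norm k \<le> norm z + norm m" using norm_triangle_ineq4[of z m] mk(3) by simp
    moreover have "D * norm y = D1 * norm y + C * (D1 * norm y)" by (simp add: D_def algebra_simps)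
    moreover have "0 \<le> D1 * norm y" "0 \<le> C * (D1 * norm y)" using C D1 by auto
    ultimately have "norm m \<le> D * norm y" "norm k \<le> D * norm y" and le: "D1 * norm y \<le> D * norm y"
      using mk(4) Cz z(3) by linarith+
    moreover have "\<forall>f\<in>F. \<bar>c f\<bar> \<le> D * norm y" using z(4) le by (meson order_trans)
    ultimately show ?thesis using mk z by blast
  qed
  \<comment> \<open>Small enough both for the compactness argument (at most 1/8) and for the
    dimension bound, where vectors of norm 2 turn \<theta> into \<open>2 * \<theta>\<close>. In
    \<epsilon>, the 1 pays for moving \<open>y\<close> and \<open>4 * D\<close> for two parts of
    norm at most \<open>2 * D * norm y\<close>.\<close>
  define \<theta> :: real where "\<theta> = 1 / 4 ^ (card F + 2)"
  define \<epsilon> where "\<epsilon> = \<theta> / (1 + 4 * D)"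
  have \<theta>: "\<theta> > 0" by (simp add: \<theta>_def)
  have "1 \<le> 2 * (4::real) ^ card F" using one_le_power[of "4::real" "card F"] by linarith
  then have \<theta>8: "\<theta> \<le> 1/8" by (simp add: \<theta>_def)
  have \<theta>2: "2 * \<theta> * 4 ^ Suc (card F) < 1" by (simp add: \<theta>_def)
  have \<epsilon>: "\<epsilon> > 0" using \<theta> D by (simp add: \<epsilon>_def)
  have \<epsilon>\<theta>: "\<epsilon> * (1 + 4 * D) = \<theta>" using D by (simp add: \<epsilon>_def)
  have "\<epsilon> * 1 \<le> \<epsilon> * (1 + 4 * D)" using \<epsilon> D by (intro mult_left_mono) auto
  then have \<epsilon>1: "\<epsilon> \<le> 1" using \<epsilon>\<theta> \<theta>8 by simp
  have "closed (ssum M' N') \<and> qdim Y2' (ssum M' N') \<le> qdim Y2 (ssum M N)"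
    if M': "closed_subspace M'" and N': "closed_subspace N'" and Y2': "closed_subspace Y2'"
      and sub: "ssum M' N' \<subseteq> Y2'"
      and gaps: "gap M M' < \<epsilon>" "gap N N' < \<epsilon>" "gap Y2' Y2 < \<epsilon>" for M' N' Y2'
  proof -
    have sM': "subspace M'" and sN': "subspace N'" and sY': "subspace Y2'"
      using M' N' Y2' by (auto simp: closed_subspace_def)
    have approx: "\<exists>m\<in>M'. \<exists>k\<in>N'. \<exists>c. norm m \<le> 4 * D * norm y \<and> norm k \<le> 4 * D * norm y
        \<and> (\<forall>f\<in>F. \<bar>c f\<bar> \<le> 4 * D * norm y) \<and> norm (y - (m + k + (\<Sum>f\<in>F. c f *\<^sub>R f))) \<le> \<theta> * norm y"
      if y: "y \<in> Y2'" for y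
    proof -
      obtain x where x: "x \<in> Y2" "norm (y - x) \<le> \<epsilon> * norm y"
        using gap_less_approx[OF sY' sY gaps(3) y] by blast
      have e1: "\<epsilon> * norm v \<le> norm v" for v :: 'a using mult_right_mono[OF \<epsilon>1 norm_ge_zero[of v]] by simp
      have "norm x \<le> norm y + norm (y - x)" using norm_triangle_ineq4[of y "y - x"] by simp
      then have "norm x \<le> 2 * norm y" using x(2) e1[of y] by linarith
      then have "D * norm x \<le> D * (2 * norm y)" using D by (rule mult_left_mono)
      then have Dx: "D * norm x \<le> 2 * D * norm y" by simp
      obtain m k c where mk: "m \<in> M" "k \<in> N" "x = m + k + (\<Sum>f\<in>F. c f *\<^sub>R f)"
        "norm m \<le> D * norm x" "norm k \<le> D * norm x" "\<forall>f\<in>F. \<bar>c f\<bar> \<le> D * norm x"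
        using repr[OF x(1)] by blast
      have near: "norm w \<le> 4 * D * norm y \<and> norm (v - w) \<le> \<epsilon> * (2 * D * norm y)"
        if "norm v \<le> D * norm x" "norm (v - w) \<le> \<epsilon> * norm v" for v w :: 'a
      proof -
        have v: "norm v \<le> 2 * D * norm y" using that(1) Dx by linarith
        have "norm w \<le> norm v + norm (v - w)" using norm_triangle_ineq4[of v "v - w"] by simp
        then have "norm w \<le> 4 * D * norm y" using that(2) v e1[of v] by linarith
        moreover have "\<epsilon> * norm v \<le> \<epsilon> * (2 * D * norm y)" using v \<epsilon> by (intro mult_left_mono) auto
        ultimately show ?thesis using that(2) by linarith
      qed
      obtain m' where m': "m' \<in> M'" "norm (m - m') \<le> \<epsilon> * norm m"
        using gap_less_approx[OF sM sM' gaps(1) mk(1)] by blast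
      obtain k' where k': "k' \<in> N'" "norm (k - k') \<le> \<epsilon> * norm k"
        using gap_less_approx[OF sN sN' gaps(2) mk(2)] by blast
      note nm = near[OF mk(4) m'(2)] and nk = near[OF mk(5) k'(2)]
      have "y - (m' + k' + (\<Sum>f\<in>F. c f *\<^sub>R f)) = (y - x) + ((m - m') + (k - k'))"
        using mk(3) by simp
      also have "norm \<dots> \<le> norm (y - x) + (norm (m - m') + norm (k - k'))"
        by (intro norm_triangle_mono order_refl)
      also have "\<dots> \<le> \<epsilon> * norm y + (\<epsilon> * (2 * D * norm y) + \<epsilon> * (2 * D * norm y))"
        using nm nk x(2) by (intro add_mono) auto
      also have "\<dots> = \<epsilon> * (1 + 4 * D) * norm y" by (simp add: algebra_simps)
      finally have "norm (y - (m' + k' + (\<Sum>f\<in>F. c f *\<^sub>R f))) \<le> \<theta> * norm y" by (simp only: \<epsilon>\<theta>)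
      moreover have "0 \<le> 2 * D * norm y" using D by simp
      then have "D * norm x \<le> 4 * D * norm y" using Dx by linarith
      then have "\<forall>f\<in>F. \<bar>c f\<bar> \<le> 4 * D * norm y" using mk(6) by (meson order_trans)
      ultimately show ?thesis using m' k' nm nk by blast
    qed
    have "closed (ssum M' N')"
    proof (rule closed_ssum_of_finite_codim_approx[OF M' N' Y2' sub finF])
      show "0 \<le> 4 * D" using D by simp
      fix y assume y: "y \<in> Y2'" "norm y = 1"
      obtain m k c where "m \<in> M'" "k \<in> N'" "norm m \<le> 4 * D" "norm k \<le> 4 * D"
        "\<forall>f\<in>F. \<bar>c f\<bar> \<le> 4 * D" "norm (y - (m + k + (\<Sum>f\<in>F. c f *\<^sub>R f))) \<le> \<theta>"
        using approx[OF y(1)] unfolding y(2) mult_1_right by blast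
      then show "\<exists>m\<in>M'. \<exists>k\<in>N'. \<exists>a. norm m \<le> 4 * D \<and> norm k \<le> 4 * D
          \<and> (\<forall>f\<in>F. \<bar>a f\<bar> \<le> 4 * D) \<and> norm (y - (m + k + (\<Sum>f\<in>F. a f *\<^sub>R f))) \<le> 1/8"
        using order_trans[OF _ \<theta>8] by blast
    qed
    moreover have "qdim Y2' (ssum M' N') \<le> enat (card F)"
    proof (rule qdim_le_of_approx[OF _ sY' sub finF \<theta>2])
      show "closed_subspace (ssum M' N')"
        using \<open>closed (ssum M' N')\<close> subspace_ssum[OF sM' sN'] by (simp add: closed_subspace_def)
      fix y assume y: "y \<in> Y2'" "norm y \<le> 2"
      obtain m k c where mk: "m \<in> M'" "k \<in> N'" "norm (y - (m + k + (\<Sum>f\<in>F. c f *\<^sub>R f))) \<le> \<theta> * norm y"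
        using approx[OF y(1)] by blast
      have "\<theta> * norm y \<le> 2 * \<theta>" using mult_left_mono[OF y(2), of \<theta>] \<theta> by simp
      moreover have "m + k + (\<Sum>f\<in>F. c f *\<^sub>R f) \<in> ssum (ssum M' N') (span F)"
        using mk by (intro ssumI) (auto intro: span_sum span_scale span_base)
      ultimately show "\<exists>w\<in>ssum (ssum M' N') (span F). norm (y - w) \<le> 2 * \<theta>"
        using mk(3) by (meson order_trans)
    qed
    ultimately show ?thesis using F(2) by simp
  qed
  then show ?thesis using \<epsilon> by blast
qed

lemma semicontinuity_dim:
  fixes M N Y1 :: "'a::banach set"
  assumes Y1: "closed_subspace Y1" and M: "closed_subspace M" and N: "closed_subspace N"
    and cl: "closed (ssum M N)" and fin: "qdim (M \<inter> N) Y1 \<noteq> \<infinity>"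
  shows "\<exists>\<epsilon>>0. \<forall>Y1' M' N'. closed_subspace Y1' \<and> closed_subspace M' \<and> closed_subspace N'
         \<and> Y1' \<subseteq> M' \<inter> N'
         \<and> gap Y1 Y1' < \<epsilon> \<and> gap M' M < \<epsilon> \<and> gap N' N < \<epsilon>
         \<longrightarrow> closed (ssum M' N') \<and> qdim (M' \<inter> N') Y1' \<le> qdim (M \<inter> N) Y1"
proof -
  have sM: "subspace M" and sN: "subspace N" and sY: "subspace Y1"
    using M N Y1 by (auto simp: closed_subspace_def)
  obtain F where F: "indep_mod F (M \<inter> N) Y1" "qdim (M \<inter> N) Y1 = enat (card F)"
      "M \<inter> N \<subseteq> ssum Y1 (span F)"
    using qdim_finite_obtain[OF sY fin] by blast
  have finF: "finite F" using F(1) by (simp add: indep_mod_def)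
  obtain E where E: "E \<ge> 0" "\<And>p. p \<in> M \<inter> N \<Longrightarrow> \<exists>z\<in>Y1. \<exists>c. p = z + (\<Sum>f\<in>F. c f *\<^sub>R f)
       \<and> norm z \<le> E * norm p \<and> (\<forall>f\<in>F. \<bar>c f\<bar> \<le> E * norm p)"
    using indep_mod_bounded_repr[OF Y1 F(1,3)] by blast
  obtain C where C: "C \<ge> 0" "bounded_decomp M N C"
    using closed_imp_bounded_decomp[OF M N cl] by blast
  define \<theta> :: real where "\<theta> = 1 / 4 ^ (card F + 2)"
  \<comment> \<open>The three error terms, in units of \<epsilon>: 2 for moving \<open>m'\<close>
    into \<open>M\<close>, \<open>6 * C\<close> for the correction into \<open>M \<inter> N\<close>,
    and \<open>E * (4 + 6 * C)\<close> for moving the \<open>Y1\<close> part into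
    \<open>Y1'\<close>.\<close>
  define B where "B = 2 + 6 * C + E * (4 + 6 * C)"
  define \<epsilon> where "\<epsilon> = \<theta> / B"
  have B: "B \<ge> 1" using C E by (simp add: B_def add_increasing2)
  have \<theta>: "\<theta> > 0" by (simp add: \<theta>_def)
  have "1 \<le> 16 * (4::real) ^ card F" using one_le_power[of "4::real" "card F"] by linarith
  then have \<theta>1: "\<theta> \<le> 1" by (simp add: \<theta>_def)
  have \<theta>2: "\<theta> * 4 ^ Suc (card F) < 1" by (simp add: \<theta>_def)
  have \<epsilon>: "\<epsilon> > 0" using \<theta> B by (simp add: \<epsilon>_def)
  have \<epsilon>\<theta>: "\<epsilon> * B = \<theta>" using B by (simp add: \<epsilon>_def)
  have "\<epsilon> * 1 \<le> \<epsilon> * B" using \<epsilon> B by (intro mult_left_mono) auto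
  then have \<epsilon>1: "\<epsilon> \<le> 1" using \<epsilon>\<theta> \<theta>1 by simp
  have "closed (ssum M' N') \<and> qdim (M' \<inter> N') Y1' \<le> qdim (M \<inter> N) Y1"
    if Y1': "closed_subspace Y1'" and M': "closed_subspace M'" and N': "closed_subspace N'"
      and sub: "Y1' \<subseteq> M' \<inter> N'"
      and gaps: "gap Y1 Y1' < \<epsilon>" "gap M' M < \<epsilon>" "gap N' N < \<epsilon>" for Y1' M' N'
  proof -
    have sM': "subspace M'" and sN': "subspace N'" and sY': "subspace Y1'"
      using M' N' Y1' by (auto simp: closed_subspace_def)
    \<comment> \<open>Used twice: with general \<open>k'\<close> for closedness of the sum, and with
      \<open>k' = - m'\<close> for vectors of \<open>M' \<inter> N'\<close>.\<close>
    have near: "\<exists>w\<in>ssum Y1' (span F). norm (m' - w) \<le> \<theta>"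
      if m': "m' \<in> M'" and k': "k' \<in> N'" and nm': "norm m' \<le> 2" and mk': "norm (m' + k') \<le> \<epsilon>" for m' k'
    proof -
      have "norm k' \<le> norm (m' + k') + norm m'" using norm_triangle_ineq4[of "m' + k'" m'] by simp
      then have nk': "norm k' \<le> 3" using nm' mk' \<epsilon>1 by linarith
      obtain m where m: "m \<in> M" "norm (m' - m) \<le> \<epsilon> * norm m'"
        using gap_less_approx[OF sM' sM gaps(2) m'] by blast
      obtain k where k: "k \<in> N" "norm (k' - k) \<le> \<epsilon> * norm k'"
        using gap_less_approx[OF sN' sN gaps(3) k'] by blast
      have mm: "norm (m' - m) \<le> \<epsilon> * 2" using m(2) mult_left_mono[OF nm', of \<epsilon>] \<epsilon> by linarith
      have kk: "norm (k' - k) \<le> \<epsilon> * 3" using k(2) mult_left_mono[OF nk', of \<epsilon>] \<epsilon> by linarith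
      have "m + k = (m' + k') + ((m - m') + (k - k'))" by simp
      also have "norm \<dots> \<le> norm (m' + k') + (norm (m' - m) + norm (k' - k))"
        by (intro norm_triangle_mono order_refl) (simp_all add: norm_minus_commute)
      finally have "norm (m + k) \<le> norm (m' + k') + (norm (m' - m) + norm (k' - k))" .
      then have mk: "norm (m + k) \<le> 6 * \<epsilon>" using mk' mm kk by linarith
      \<comment> \<open>\<open>m + k\<close> has norm at most \<open>6 * \<epsilon>\<close>, so its
        controlled splitting has small \<open>m1\<close>. Both splittings have the same sum, hence
        \<open>m - m1\<close> lies in \<open>M \<inter> N\<close> and is close to
        \<open>m\<close>.\<close>
      obtain m1 k1 where 1: "m1 \<in> M" "k1 \<in> N" "m + k = m1 + k1" "norm m1 \<le> C * norm (m + k)"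
        using C(2) ssumI[OF m(1) k(1)] unfolding bounded_decomp_def by blast
      have m1: "norm m1 \<le> \<epsilon> * (6 * C)" using 1(4) mult_left_mono[OF mk C(1)] by (simp add: mult_ac)
      have "m - m1 = k1 - k" using 1(3) by (simp add: algebra_simps)
      then have p: "m - m1 \<in> M \<inter> N"
        using subspace_diff[OF sM m(1) 1(1)] subspace_diff[OF sN 1(2) k(1)] by simp
      have "norm m \<le> norm m' + norm (m' - m)" using norm_triangle_ineq4[of m' "m' - m"] by simp
      then have "norm m \<le> 4" using nm' mm \<epsilon>1 by linarith
      moreover have "\<epsilon> * (6 * C) \<le> 1 * (6 * C)" using \<epsilon>1 C by (intro mult_right_mono) auto
      ultimately have np: "norm (m - m1) \<le> 4 + 6 * C" using norm_triangle_ineq4[of m m1] m1 by linarith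
      obtain y c where y: "y \<in> Y1" "m - m1 = y + (\<Sum>f\<in>F. c f *\<^sub>R f)" "norm y \<le> E * norm (m - m1)"
        using E(2)[OF p] by blast
      obtain y' where y': "y' \<in> Y1'" "norm (y - y') \<le> \<epsilon> * norm y"
        using gap_less_approx[OF sY sY' gaps(1) y(1)] by blast
      have "norm y \<le> E * (4 + 6 * C)" using y(3) mult_left_mono[OF np E(1)] by linarith
      then have "\<epsilon> * norm y \<le> \<epsilon> * (E * (4 + 6 * C))" using \<epsilon> by (intro mult_left_mono) auto
      then have yy: "norm (y - y') \<le> \<epsilon> * (E * (4 + 6 * C))" using y'(2) by linarith
      define w where "w = y' + (\<Sum>f\<in>F. c f *\<^sub>R f)"
      have "w \<in> ssum Y1' (span F)"
        unfolding w_def using y' by (intro ssumI) (auto intro: span_sum span_scale span_base)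
      moreover have "norm (m' - w) \<le> \<theta>"
      proof -
        have "m' - w = (m' - m) + (m1 + (y - y'))"
          using y(2) by (simp add: w_def algebra_simps)
        also have "norm \<dots> \<le> \<epsilon> * 2 + (\<epsilon> * (6 * C) + \<epsilon> * (E * (4 + 6 * C)))"
          by (intro norm_triangle_mono mm m1 yy)
        also have "\<dots> = \<theta>" unfolding \<epsilon>\<theta>[symmetric] B_def by (simp add: algebra_simps)
        finally show ?thesis .
      qed
      ultimately show ?thesis by blast
    qed
    have "closed (ssum M' N')"
    proof (rule closed_ssum_of_finite_dim_approx[OF M' N' finF \<epsilon> \<theta>2])
      fix m k assume "m \<in> M'" "k \<in> N'" "norm m \<le> 2" "norm (m + k) \<le> \<epsilon>"
      then show "\<exists>w\<in>ssum (M' \<inter> N') (span F). norm (m - w) \<le> \<theta>"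
        using near ssum_mono[OF sub order_refl] by blast
    qed
    moreover have "qdim (M' \<inter> N') Y1' \<le> enat (card F)"
    proof (rule qdim_le_of_approx[OF Y1' subspace_inter[OF sM' sN'] sub finF \<theta>2])
      fix y assume "y \<in> M' \<inter> N'" "norm y \<le> 2"
      then show "\<exists>w\<in>ssum Y1' (span F). norm (y - w) \<le> \<theta>"
        using near[of y "- y"] subspace_neg[OF sN'] \<epsilon> by auto
    qed
    ultimately show ?thesis using F(2) by simp
  qed
  then show ?thesis using \<epsilon> by blast
qed

theorem theorem1p1:
  fixes Y1 M N Y2 :: "'a::banach set"
  assumes "closed_subspace Y1" and "closed_subspace M" and "closed_subspace N"
    and "closed_subspace Y2"
    and "closed (ssum M N)"
    and "Y1 \<subseteq> M \<inter> N" and "M \<inter> N \<subseteq> ssum M N" and "ssum M N \<subseteq> Y2"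
  shows
    "(qdim Y2 (ssum M N) \<noteq> \<infinity> \<longrightarrow>
      (\<exists>\<epsilon>>0. \<forall>M' N' Y2'. closed_subspace M' \<and> closed_subspace N' \<and> closed_subspace Y2'
         \<and> ssum M' N' \<subseteq> Y2'
         \<and> gap M M' < \<epsilon> \<and> gap N N' < \<epsilon> \<and> gap Y2' Y2 < \<epsilon>
         \<longrightarrow> closed (ssum M' N') \<and> qdim Y2' (ssum M' N') \<le> qdim Y2 (ssum M N)))
   \<and> (qdim (M \<inter> N) Y1 \<noteq> \<infinity> \<longrightarrow>
      (\<exists>\<epsilon>>0. \<forall>Y1' M' N'. closed_subspace Y1' \<and> closed_subspace M' \<and> closed_subspace N'
         \<and> Y1' \<subseteq> M' \<inter> N'
         \<and> gap Y1 Y1' < \<epsilon> \<and> gap M' M < \<epsilon> \<and> gap N' N < \<epsilon>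
         \<longrightarrow> closed (ssum M' N') \<and> qdim (M' \<inter> N') Y1' \<le> qdim (M \<inter> N) Y1))"
  using semicontinuity_codim[OF assms(2-5)] semicontinuity_dim[OF assms(1-3,5)] by (intro conjI impI)

end
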